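(* Let $n\in\{1,2,\dots\}$ or $n=\infty$. Let $T:=[T_1,\dots,T_n]$, $T_i\in B(\mathcal H)$, be a row contraction and let $V:=[V_1,\dots,V_n]$, $V_i\in B(\mathcal K)$, be an isometric lifting of $T$ on a Hilbert space $\mathcal K\supseteq\mathcal H$. Let $Y:=[Y_1,\dots,Y_n]$, $Y_i\in B(\mathcal Y)$, be another row contraction and let $W:=[W_1,\dots,W_n]$, $W_i\in B(\mathcal X)$, be an isometric lifting of $Y$ on a Hilbert space $\mathcal X\supseteq\mathcal Y$. If $A\in B(\mathcal Y,\mathcal H)$ is a contraction, then there is a contraction $B\in B(\mathcal X,\mathcal K)$ such that $B^*|_{\mathcal H}=A^*$ and $$\|V_iB-BW_i\|\le\sqrt2\,\big\|[T_1A-AY_1,\ \dots,\ T_nA-AY_n]\big\|^{1/2}$$ for every $i=1,\dots,n$. Moreover, $\sqrt2$ is the best possible constant, i.e. it cannot be replaced by a smaller constant for which the result holds for all such data.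
   Context: All spaces are complex Hilbert spaces; $B(\mathcal X,\mathcal H)$ denotes the bounded linear operators from $\mathcal X$ to $\mathcal H$ and $B(\mathcal H)=B(\mathcal H,\mathcal H)$. A row contraction is a sequence $[T_1,\dots,T_n]$ with $T_i\in B(\mathcal H)$ and $T_1T_1^*+\cdots+T_nT_n^*\le I_{\mathcal H}$. An isometric lifting of $T$ on $\mathcal K\supseteq\mathcal H$ is a sequence $[V_1,\dots,V_n]$, $V_i\in B(\mathcal K)$, with $V_i^*V_j=\delta_{ij}I_{\mathcal K}$ and $P_{\mathcal H}V_i=T_iP_{\mathcal H}$ for all $i,j$, where $P_{\mathcal H}$ is the orthogonal projection of $\mathcal K$ onto $\mathcal H$. For $M_i\in B(\mathcal Y,\mathcal H)$, $[M_1,\dots,M_n]$ denotes the row operator $\bigoplus_{i=1}^n\mathcal Y\to\mathcal H$, $\oplus_i y_i\mapsto\sum_iM_iy_i$. The identity $B^*|_{\mathcal H}=A^*$ means $B^*h=A^*h\in\mathcal Y\subseteq\mathcal X$ for all $h\in\mathcal H$. *)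

theory Defs
  imports "HOL-Analysis.Analysis" "HOL-Library.Extended_Nat"
begin

section \<open>Complex Hilbert spaces\<close>

class complex_vector = real_vector +
  fixes scaleC :: "complex \<Rightarrow> 'a \<Rightarrow> 'a" (infixr "*\<^sub>C" 75)
  assumes scaleC_add_right: "a *\<^sub>C (x + y) = a *\<^sub>C x + a *\<^sub>C y"
    and scaleC_add_left: "(a + b) *\<^sub>C x = a *\<^sub>C x + b *\<^sub>C x"
    and scaleC_scaleC: "a *\<^sub>C b *\<^sub>C x = (a * b) *\<^sub>C x"
    and scaleC_one: "1 *\<^sub>C x = x"
    and scaleR_scaleC: "r *\<^sub>R x = complex_of_real r *\<^sub>C x"

text \<open>The inner product is linear in its first argument. Its real part is the
  real inner product of the library, so that positive definiteness and
  the identity \<open>norm x = sqrt (Re (cinner x x))\<close> are inherited from \<^class>\<open>real_inner\<close>.\<close>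

class complex_inner = complex_vector + real_inner +
  fixes cinner :: "'a \<Rightarrow> 'a \<Rightarrow> complex"
  assumes cinner_commute: "cinner x y = cnj (cinner y x)"
    and cinner_add_left: "cinner (x + y) z = cinner x z + cinner y z"
    and cinner_scaleC_left: "cinner (a *\<^sub>C x) y = a * cinner x y"
    and inner_eq_Re_cinner: "inner x y = Re (cinner x y)"

class complex_hilbert = complex_inner + complete_space

definition closed_csubspace :: "'a::complex_hilbert set \<Rightarrow> bool" where
  "closed_csubspace E \<longleftrightarrow> 0 \<in> E \<and> (\<forall>x\<in>E. \<forall>y\<in>E. x + y \<in> E) \<and>
     (\<forall>a. \<forall>x\<in>E. a *\<^sub>C x \<in> E) \<and> closed E"


section \<open>Operators between closed subspaces\<close>

text \<open>Hilbert spaces are closed subspaces of types of class \<^class>\<open>complex_hilbert\<close>. An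
  operator from \<open>E\<close> to \<open>F\<close> is a HOL function of which only the values on \<open>E\<close> matter;
  all notions below depend only on these values.\<close>

definition bounded_ops ::
    "'a::complex_hilbert set \<Rightarrow> 'b::complex_hilbert set \<Rightarrow> ('a \<Rightarrow> 'b) set" where
  "bounded_ops E F = {A. (\<forall>x\<in>E. A x \<in> F) \<and>
     (\<forall>x\<in>E. \<forall>y\<in>E. A (x + y) = A x + A y) \<and>
     (\<forall>a. \<forall>x\<in>E. A (a *\<^sub>C x) = a *\<^sub>C A x) \<and>
     (\<exists>C. \<forall>x\<in>E. norm (A x) \<le> C * norm x)}"

text \<open>For \<open>E = UNIV\<close> this is the library's \<^const>\<open>onorm\<close>.\<close>

definition onorm_on :: "'a::complex_hilbert set \<Rightarrow> ('a \<Rightarrow> 'b::complex_hilbert) \<Rightarrow> real" where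
  "onorm_on E A = (SUP x\<in>E. norm (A x) / norm x)"

definition contractions ::
    "'a::complex_hilbert set \<Rightarrow> 'b::complex_hilbert set \<Rightarrow> ('a \<Rightarrow> 'b) set" where
  "contractions E F = {A \<in> bounded_ops E F. onorm_on E A \<le> 1}"

text \<open>For \<open>A \<in> bounded_ops E F\<close> and \<open>h \<in> F\<close>, \<open>adj_on E A h\<close> is the value \<open>A\<^sup>* h \<in> E\<close> of the
  Hilbert space adjoint.\<close>

definition adj_on ::
    "'a::complex_hilbert set \<Rightarrow> ('a \<Rightarrow> 'b::complex_hilbert) \<Rightarrow> 'b \<Rightarrow> 'a" where
  "adj_on E A h = (THE y. y \<in> E \<and> (\<forall>x\<in>E. cinner (A x) h = cinner x y))"

definition proj_on :: "'a::complex_hilbert set \<Rightarrow> 'a \<Rightarrow> 'a" where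
  "proj_on E x = (THE p. p \<in> E \<and> (\<forall>y\<in>E. cinner (x - p) y = 0))"


section \<open>Row contractions and isometric liftings\<close>

text \<open>Sequences of length \<open>n\<close>, where \<open>n = \<infinity>\<close> is allowed, are indexed by \<open>1, 2, \<dots>\<close>.\<close>

definition idx :: "enat \<Rightarrow> nat set" where
  "idx n = {i. 1 \<le> i \<and> enat i \<le> n}"

text \<open>For \<open>n = \<infinity>\<close> the sum of the operators \<open>T i (T i)\<^sup>*\<close> is taken in the strong
  operator topology.  Being a sum of positive operators, it has a real quadratic form.\<close>

definition row_contraction ::
    "enat \<Rightarrow> 'a::complex_hilbert set \<Rightarrow> (nat \<Rightarrow> 'a \<Rightarrow> 'a) \<Rightarrow> bool" where
  "row_contraction n H T \<longleftrightarrow> (\<forall>i\<in>idx n. T i \<in> bounded_ops H H) \<and>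
     (\<forall>h\<in>H. (\<lambda>i. T i (adj_on H (T i) h)) summable_on idx n \<and>
        Re (cinner (\<Sum>\<^sub>\<infinity>i\<in>idx n. T i (adj_on H (T i) h)) h) \<le> Re (cinner h h))"

text \<open>The space \<open>K\<close> of the lifting is the whole type \<open>'a\<close>.\<close>

definition isometric_lifting ::
    "enat \<Rightarrow> 'a::complex_hilbert set \<Rightarrow> (nat \<Rightarrow> 'a \<Rightarrow> 'a) \<Rightarrow> (nat \<Rightarrow> 'a \<Rightarrow> 'a) \<Rightarrow> bool" where
  "isometric_lifting n H T V \<longleftrightarrow>
     (\<forall>i\<in>idx n. V i \<in> bounded_ops UNIV UNIV) \<and>
     (\<forall>i\<in>idx n. \<forall>j\<in>idx n. \<forall>x. adj_on UNIV (V i) (V j x) = (if i = j then x else 0)) \<and>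
     (\<forall>i\<in>idx n. \<forall>x. proj_on H (V i x) = T i (proj_on H x))"

text \<open>The Hilbert space direct sum of \<open>n\<close> copies of \<open>E\<close>, its norm, and the operator norm of
  the row operator \<open>[M\<^sub>1, \<dots>, M\<^sub>n]\<close> on it.  Entries of a family outside \<open>idx n\<close> are
  irrelevant.\<close>

definition direct_sum :: "enat \<Rightarrow> 'a::complex_hilbert set \<Rightarrow> (nat \<Rightarrow> 'a) set" where
  "direct_sum n E = {y. (\<forall>i\<in>idx n. y i \<in> E) \<and> (\<lambda>i. (norm (y i))\<^sup>2) summable_on idx n}"

definition direct_sum_norm :: "enat \<Rightarrow> (nat \<Rightarrow> 'a::complex_hilbert) \<Rightarrow> real" where
  "direct_sum_norm n y = sqrt (\<Sum>\<^sub>\<infinity>i\<in>idx n. (norm (y i))\<^sup>2)"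

definition row_norm ::
    "enat \<Rightarrow> 'a::complex_hilbert set \<Rightarrow> (nat \<Rightarrow> 'a \<Rightarrow> 'b::complex_hilbert) \<Rightarrow> real" where
  "row_norm n E M =
     (SUP y\<in>direct_sum n E. norm (\<Sum>\<^sub>\<infinity>i\<in>idx n. M i (y i)) / direct_sum_norm n y)"


section \<open>The Hilbert space of square-summable sequences\<close>

text \<open>For \<open>n \<ge> 2\<close> a nonzero space carrying isometries with orthogonal ranges is
  infinite-dimensional; this is a concrete such space, needed for optimality.\<close>

typedef ell2 = "{f :: nat \<Rightarrow> complex. summable (\<lambda>i. (cmod (f i))\<^sup>2)}"
  by (rule exI[of _ "\<lambda>_. 0"]) simp

setup_lifting type_definition_ell2

lemma ell2_summable_mult:
  assumes "summable (\<lambda>i. (cmod (f i))\<^sup>2)" "summable (\<lambda>i. (cmod (g i))\<^sup>2)"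
  shows "summable (\<lambda>i. f i * cnj (g i))"
proof (rule summable_comparison_test'[where N = 0])
  show "summable (\<lambda>i. (cmod (f i))\<^sup>2 + (cmod (g i))\<^sup>2)"
    using assms by (rule summable_add)
  fix i :: nat
  have "2 * (cmod (f i) * cmod (g i)) \<le> (cmod (f i))\<^sup>2 + (cmod (g i))\<^sup>2"
    using sum_squares_bound[of "cmod (f i)" "cmod (g i)"] by simp
  moreover have "0 \<le> cmod (f i) * cmod (g i)" by simp
  ultimately show "norm (f i * cnj (g i)) \<le> (cmod (f i))\<^sup>2 + (cmod (g i))\<^sup>2"
    unfolding norm_mult complex_mod_cnj by linarith
qed

lemma ell2_summable_add:
  assumes "summable (\<lambda>i. (cmod (f i))\<^sup>2)" "summable (\<lambda>i. (cmod (g i))\<^sup>2)"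
  shows "summable (\<lambda>i. (cmod (f i + g i))\<^sup>2)"
proof (rule summable_comparison_test'[where N = 0])
  show "summable (\<lambda>i. 2 * (cmod (f i))\<^sup>2 + 2 * (cmod (g i))\<^sup>2)"
    using assms by (intro summable_add summable_mult)
  fix i :: nat
  have "(cmod (f i + g i))\<^sup>2 \<le> (cmod (f i) + cmod (g i))\<^sup>2"
    by (intro power_mono norm_triangle_ineq) simp
  also have "\<dots> \<le> 2 * (cmod (f i))\<^sup>2 + 2 * (cmod (g i))\<^sup>2"
    using sum_squares_bound[of "cmod (f i)" "cmod (g i)"] by (simp add: power2_sum)
  finally show "norm ((cmod (f i + g i))\<^sup>2) \<le> 2 * (cmod (f i))\<^sup>2 + 2 * (cmod (g i))\<^sup>2"
    by simp
qed

lemma ell2_summable_scale: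
  assumes "summable (\<lambda>i. (cmod (f i))\<^sup>2)"
  shows "summable (\<lambda>i. (cmod (a * f i))\<^sup>2)"
  using summable_mult[OF assms, of "(cmod a)\<^sup>2"] by (simp add: norm_mult power_mult_distrib)

instantiation ell2 :: complex_inner
begin

lift_definition zero_ell2 :: ell2 is "\<lambda>_. 0" by simp

lift_definition plus_ell2 :: "ell2 \<Rightarrow> ell2 \<Rightarrow> ell2" is "\<lambda>f g i. f i + g i"
  by (rule ell2_summable_add)

lift_definition uminus_ell2 :: "ell2 \<Rightarrow> ell2" is "\<lambda>f i. - f i" by simp

lift_definition minus_ell2 :: "ell2 \<Rightarrow> ell2 \<Rightarrow> ell2" is "\<lambda>f g i. f i - g i"
  subgoal for f g using ell2_summable_add[of f "\<lambda>i. - g i"] by simp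
  done

lift_definition scaleC_ell2 :: "complex \<Rightarrow> ell2 \<Rightarrow> ell2" is "\<lambda>a f i. a * f i"
  by (rule ell2_summable_scale)

lift_definition scaleR_ell2 :: "real \<Rightarrow> ell2 \<Rightarrow> ell2" is "\<lambda>r f i. complex_of_real r * f i"
  by (rule ell2_summable_scale)

lift_definition cinner_ell2 :: "ell2 \<Rightarrow> ell2 \<Rightarrow> complex" is "\<lambda>f g. \<Sum>i. f i * cnj (g i)" .

definition inner_ell2 :: "ell2 \<Rightarrow> ell2 \<Rightarrow> real" where
  "inner_ell2 f g = Re (cinner f g)"

definition norm_ell2 :: "ell2 \<Rightarrow> real" where
  "norm_ell2 f = sqrt (inner f f)"

definition dist_ell2 :: "ell2 \<Rightarrow> ell2 \<Rightarrow> real" where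
  "dist_ell2 f g = norm (f - g)"

definition sgn_ell2 :: "ell2 \<Rightarrow> ell2" where
  "sgn_ell2 f = inverse (norm f) *\<^sub>R f"

definition uniformity_ell2 :: "(ell2 \<times> ell2) filter" where
  "uniformity_ell2 = (INF e\<in>{0<..}. principal {(f, g). dist f g < e})"

definition open_ell2 :: "ell2 set \<Rightarrow> bool" where
  "open_ell2 U \<longleftrightarrow> (\<forall>x\<in>U. eventually (\<lambda>(x', y). x' = x \<longrightarrow> y \<in> U) uniformity)"

instance
proof
  fix x y z :: ell2 and a b :: complex and r s :: real
  show "x + y + z = x + (y + z)" "x + y = y + x" "0 + x = x" "- x + x = 0" "x - y = x + - y"
    by (transfer; simp add: algebra_simps)+
  show "r *\<^sub>R (x + y) = r *\<^sub>R x + r *\<^sub>R y" "(r + s) *\<^sub>R x = r *\<^sub>R x + s *\<^sub>R x"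
    "r *\<^sub>R s *\<^sub>R x = (r * s) *\<^sub>R x" "1 *\<^sub>R x = x"
    by (transfer; simp add: algebra_simps)+
  show "a *\<^sub>C (x + y) = a *\<^sub>C x + a *\<^sub>C y" "(a + b) *\<^sub>C x = a *\<^sub>C x + b *\<^sub>C x"
    "a *\<^sub>C b *\<^sub>C x = (a * b) *\<^sub>C x" "1 *\<^sub>C x = x" "r *\<^sub>R x = complex_of_real r *\<^sub>C x"
    by (transfer; simp add: algebra_simps)+
  show comm: "cinner x y = cnj (cinner y x)" for x y :: ell2
  proof transfer
    fix f g :: "nat \<Rightarrow> complex"
    assume "summable (\<lambda>i. (cmod (f i))\<^sup>2)" "summable (\<lambda>i. (cmod (g i))\<^sup>2)"
    then have "(\<lambda>i. g i * cnj (f i)) sums (\<Sum>i. g i * cnj (f i))"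
      by (intro summable_sums ell2_summable_mult)
    then have "(\<lambda>i. cnj (g i * cnj (f i))) sums cnj (\<Sum>i. g i * cnj (f i))"
      by (simp only: sums_cnj)
    then show "(\<Sum>i. f i * cnj (g i)) = cnj (\<Sum>i. g i * cnj (f i))"
      by (simp add: sums_iff mult.commute)
  qed
  show add: "cinner (x + y) z = cinner x z + cinner y z"
    by transfer (simp add: distrib_right suminf_add[symmetric] ell2_summable_mult)
  show scale: "cinner (a *\<^sub>C x) y = a * cinner x y" for a
    by transfer (simp add: mult.assoc suminf_mult ell2_summable_mult)
  show "inner x y = Re (cinner x y)" by (fact inner_ell2_def)
  show "inner x y = inner y x"
    using comm[of x y] by (simp add: inner_ell2_def)
  show "inner (x + y) z = inner x z + inner y z"
    using add by (simp add: inner_ell2_def)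
  have "r *\<^sub>R x = complex_of_real r *\<^sub>C x" by transfer simp
  then show "inner (r *\<^sub>R x) y = r * inner x y"
    using scale[of "complex_of_real r"] by (simp add: inner_ell2_def)
  have sq: "(\<Sum>i. f i * cnj (f i)) = complex_of_real (\<Sum>i. (cmod (f i))\<^sup>2)"
    if "summable (\<lambda>i. (cmod (f i))\<^sup>2)" for f :: "nat \<Rightarrow> complex"
    using suminf_of_real[OF that, where 'a = complex] by (simp add: complex_norm_square[symmetric])
  show "0 \<le> inner x x"
    unfolding inner_ell2_def by transfer (simp add: sq suminf_nonneg)
  show "inner x x = 0 \<longleftrightarrow> x = 0"
    unfolding inner_ell2_def by transfer (auto simp: sq suminf_eq_zero_iff fun_eq_iff)
  show "norm x = sqrt (inner x x)" by (fact norm_ell2_def)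
  show "dist x y = norm (x - y)" by (fact dist_ell2_def)
  show "sgn x = inverse (norm x) *\<^sub>R x" by (fact sgn_ell2_def)
  show "uniformity = (INF e\<in>{0<..}. principal {(f, g :: ell2). dist f g < e})"
    by (fact uniformity_ell2_def)
  show "open U \<longleftrightarrow> (\<forall>x\<in>U. eventually (\<lambda>(x', y). x' = x \<longrightarrow> y \<in> U) uniformity)"
    for U :: "ell2 set"
    by (fact open_ell2_def)
qed

end

lemma ell2_summable: "summable (\<lambda>i. (cmod (Rep_ell2 x i))\<^sup>2)"
  using Rep_ell2[of x] by simp

lemma ell2_norm_square: "(norm x)\<^sup>2 = (\<Sum>i. (cmod (Rep_ell2 x i))\<^sup>2)"
proof -
  have "cinner x x = complex_of_real (\<Sum>i. (cmod (Rep_ell2 x i))\<^sup>2)"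
    using suminf_of_real[OF ell2_summable[of x], where 'a = complex]
    by (simp add: complex_norm_square[symmetric] cinner_ell2.rep_eq)
  then show ?thesis
    by (simp add: power2_norm_eq_inner inner_ell2_def)
qed

instance ell2 :: complex_hilbert
proof
  fix X :: "nat \<Rightarrow> ell2"
  assume X: "Cauchy X"
  have partial: "(\<Sum>i<k. (cmod (Rep_ell2 (x - y) i))\<^sup>2) \<le> (norm (x - y))\<^sup>2" for x y k
    unfolding ell2_norm_square by (intro sum_le_suminf ell2_summable) auto
  have coord: "cmod (Rep_ell2 x i - Rep_ell2 y i) \<le> norm (x - y)" for x y i
  proof -
    have "(cmod (Rep_ell2 (x - y) i))\<^sup>2 \<le> (\<Sum>j<Suc i. (cmod (Rep_ell2 (x - y) j))\<^sup>2)"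
      by (rule member_le_sum) auto
    also note partial
    finally show ?thesis
      by (simp add: minus_ell2.rep_eq power2_le_iff_abs_le)
  qed
  have "Cauchy (\<lambda>m. Rep_ell2 (X m) i)" for i
  proof (rule CauchyI)
    fix e :: real assume "0 < e"
    then obtain N where "\<forall>m\<ge>N. \<forall>n\<ge>N. norm (X m - X n) < e"
      using CauchyD[OF X] by blast
    then show "\<exists>N. \<forall>m\<ge>N. \<forall>n\<ge>N. norm (Rep_ell2 (X m) i - Rep_ell2 (X n) i) < e"
      using coord le_less_trans by blast
  qed
  then have "\<exists>l. (\<lambda>m. Rep_ell2 (X m) i) \<longlonglongrightarrow> l" for i
    by (simp add: Cauchy_convergent_iff convergent_def)
  then obtain l where l: "\<And>i. (\<lambda>m. Rep_ell2 (X m) i) \<longlonglongrightarrow> l i" by metis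
  have bound: "(\<Sum>i<k. (cmod (Rep_ell2 (X m) i - l i))\<^sup>2) \<le> e\<^sup>2"
    if N: "\<forall>m\<ge>N. \<forall>n\<ge>N. norm (X m - X n) < e" and m: "m \<ge> N" for N e m k
  proof (rule LIMSEQ_le_const2)
    show "(\<lambda>n. \<Sum>i<k. (cmod (Rep_ell2 (X m) i - Rep_ell2 (X n) i))\<^sup>2)
        \<longlonglongrightarrow> (\<Sum>i<k. (cmod (Rep_ell2 (X m) i - l i))\<^sup>2)"
      by (intro tendsto_intros l)
    have "(\<Sum>i<k. (cmod (Rep_ell2 (X m) i - Rep_ell2 (X n) i))\<^sup>2) \<le> e\<^sup>2" if "n \<ge> N" for n
    proof -
      have "(norm (X m - X n))\<^sup>2 \<le> e\<^sup>2"
        using N m that by (intro power_mono) (auto simp: less_imp_le)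
      then show ?thesis
        using partial[of "X m" "X n" k] by (simp add: minus_ell2.rep_eq)
    qed
    then show "\<exists>N. \<forall>n\<ge>N. (\<Sum>i<k. (cmod (Rep_ell2 (X m) i - Rep_ell2 (X n) i))\<^sup>2) \<le> e\<^sup>2" by blast
  qed
  have summ: "summable (\<lambda>i. (cmod (Rep_ell2 (X m) i - l i))\<^sup>2)"
    if "\<forall>m\<ge>N. \<forall>n\<ge>N. norm (X m - X n) < e" "m \<ge> N" for N e m
    by (rule bounded_imp_summable[where B = "e\<^sup>2"])
      (use bound[OF that, of "Suc _"] in \<open>simp_all add: lessThan_Suc_atMost\<close>)
  obtain N0 where N0: "\<forall>m\<ge>N0. \<forall>n\<ge>N0. norm (X m - X n) < 1"
    using CauchyD[OF X, of 1] by auto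
  have "summable (\<lambda>i. (cmod (Rep_ell2 (X N0) i + (-1) * (Rep_ell2 (X N0) i - l i)))\<^sup>2)"
    by (intro ell2_summable_add ell2_summable_scale ell2_summable summ[OF N0]) simp
  then have "summable (\<lambda>i. (cmod (l i))\<^sup>2)" by simp
  then have L: "Rep_ell2 (Abs_ell2 l) = l" by (simp add: Abs_ell2_inverse)
  have "X \<longlonglongrightarrow> Abs_ell2 l"
  proof (rule LIMSEQ_I)
    fix r :: real assume "0 < r"
    then obtain N where N: "\<forall>m\<ge>N. \<forall>n\<ge>N. norm (X m - X n) < r / 2"
      using CauchyD[OF X, of "r / 2"] by auto
    have "norm (X m - Abs_ell2 l) < r" if m: "m \<ge> N" for m
    proof -
      have "(norm (X m - Abs_ell2 l))\<^sup>2 \<le> (r / 2)\<^sup>2"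
        unfolding ell2_norm_square minus_ell2.rep_eq L
        by (intro suminf_le_const summ[OF N m] bound[OF N m])
      then have "norm (X m - Abs_ell2 l) \<le> r / 2"
        using \<open>0 < r\<close> by (simp add: power2_le_iff_abs_le)
      then show ?thesis using \<open>0 < r\<close> by simp
    qed
    then show "\<exists>N. \<forall>m\<ge>N. norm (X m - Abs_ell2 l) < r" by blast
  qed
  then show "convergent X" by (auto simp: convergent_def)
qed

end

theory Submission
  imports Defs
begin

text \<open>Replacing \<open>A\<close> by \<open>A P\<^sub>Y\<close>, which does not increase \<open>d = \<parallel>[T\<^sub>i A - A Y\<^sub>i]\<parallel>\<close>, one may assume that
  \<open>Y\<^sub>i = W\<^sub>i\<close>. For any contractive \<open>B\<close> with \<open>P\<^sub>H B = A\<close> the part \<open>N B\<close> of the row operator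
  \<open>[V\<^sub>i B]\<close> orthogonal to \<open>H\<close> satisfies, for \<open>z = \<Sum>W\<^sub>i x\<^sub>i\<close> and \<open>D = [T\<^sub>i A - A W\<^sub>i]\<close>,
  \<open>\<parallel>N B z\<parallel>\<^sup>2 \<le> (\<parallel>z\<parallel>\<^sup>2 - \<parallel>A z\<parallel>\<^sup>2) + (2 d \<parallel>z\<parallel>\<^sup>2 - \<parallel>D z\<parallel>\<^sup>2)\<close>. As in Douglas' lemma, \<open>N B\<close> therefore splits into
  \<open>C z + E z\<close> with \<open>\<parallel>C x\<parallel>\<^sup>2 \<le> \<parallel>x\<parallel>\<^sup>2 - \<parallel>A x\<parallel>\<^sup>2\<close> and \<open>\<parallel>E z\<parallel>\<^sup>2 \<le> 2 d \<parallel>z\<parallel>\<^sup>2 - \<parallel>D z\<parallel>\<^sup>2\<close>; then \<open>A + C\<close> is again a contractive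
  extension, and \<open>(A + C) z\<close> differs from \<open>[V\<^sub>i B] z\<close> by at most \<open>\<surd>(2 d) \<parallel>z\<parallel>\<close>. Iterating
  \<open>B \<mapsto> A + C\<close> from \<open>A\<close> has mutually orthogonal increments and converges to the required
  operator. Square roots of operators and completions are avoided by computing the splitting from
  approximate minimisers.\<close>

section \<open>Complex inner products\<close>

definition complex_linear :: "('a::complex_vector \<Rightarrow> 'b::complex_vector) \<Rightarrow> bool" where
  "complex_linear f \<longleftrightarrow> (\<forall>x y. f (x + y) = f x + f y) \<and> (\<forall>a x. f (a *\<^sub>C x) = a *\<^sub>C f x)"

lemma complex_linear_linear: "complex_linear f \<Longrightarrow> linear f"
  by (rule linearI) (auto simp: complex_linear_def scaleR_scaleC)

lemma complex_linear_scaleC: "complex_linear f \<Longrightarrow> f (a *\<^sub>C x) = a *\<^sub>C f x"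
  by (simp add: complex_linear_def)

lemmas complex_linear_simps =
  linear_add[OF complex_linear_linear] linear_diff[OF complex_linear_linear]
  linear_0[OF complex_linear_linear] linear_sum[OF complex_linear_linear]
  complex_linear_scaleC

lemma scaleC_zero [simp]: "a *\<^sub>C (0::'a::complex_vector) = 0"
  using scaleC_add_right[of a "0::'a" 0] by simp

lemma complex_linear_scaleC_self: "complex_linear (\<lambda>x. a *\<^sub>C x)"
  by (simp add: complex_linear_def scaleC_add_right scaleC_scaleC mult.commute)

lemmas scaleC_linear_simps =
  linear_diff[OF complex_linear_linear[OF complex_linear_scaleC_self]]
  linear_neg[OF complex_linear_linear[OF complex_linear_scaleC_self]]
  linear_sum[OF complex_linear_linear[OF complex_linear_scaleC_self]]

lemma cinner_scaleC_right: "cinner x (a *\<^sub>C y) = cnj a * cinner x y"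
  by (metis cinner_commute cinner_scaleC_left complex_cnj_mult)

lemma inner_scaleC_left: "inner (a *\<^sub>C x) y = inner x (cnj a *\<^sub>C y)"
  for x :: "'a::complex_inner"
  by (simp add: inner_eq_Re_cinner cinner_scaleC_left cinner_scaleC_right)

text \<open>The imaginary part is the real part after multiplying the second argument by
  \<open>\<i>\<close>. Identities on complex subspaces can thus be proved for the real inner product
  and transferred back.\<close>

lemma cinner_eq_inner: "cinner x y = Complex (inner x y) (inner x (\<i> *\<^sub>C y))"
  by (simp add: inner_eq_Re_cinner cinner_scaleC_right complex_eq_iff)

lemma cinner_self: "cinner x x = of_real ((norm x)\<^sup>2)"
proof -
  have "Im (cinner x x) = 0"
    using cinner_commute[of x x] by (simp add: complex_eq_iff)
  then show ?thesis
    by (simp add: complex_eq_iff power2_norm_eq_inner inner_eq_Re_cinner)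
qed

lemma norm_scaleC: "norm (a *\<^sub>C x) = cmod a * norm x"
  for x :: "'a::complex_inner"
proof -
  have "complex_of_real ((norm (a *\<^sub>C x))\<^sup>2) = (a * cnj a) * cinner x x"
    by (simp only: cinner_self[symmetric] cinner_scaleC_left cinner_scaleC_right mult_ac)
  also have "\<dots> = complex_of_real ((cmod a * norm x)\<^sup>2)"
    by (simp only: complex_norm_square[symmetric] cinner_self power_mult_distrib of_real_mult)
  finally show ?thesis by (simp only: of_real_eq_iff power2_eq_iff_nonneg norm_ge_zero mult_nonneg_nonneg)
qed

lemma tendsto_scaleC:
  fixes l :: "'a::complex_inner"
  assumes "(f \<longlongrightarrow> l) F"
  shows "((\<lambda>x. a *\<^sub>C f x) \<longlongrightarrow> a *\<^sub>C l) F"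
proof -
  have "bounded_linear (\<lambda>x::'a. a *\<^sub>C x)"
    by (rule bounded_linear_intro[where K = "cmod a"])
      (auto simp: scaleC_add_right scaleR_scaleC scaleC_scaleC mult.commute norm_scaleC)
  then show ?thesis using assms by (rule bounded_linear.tendsto)
qed

lemma closed_csubspace_subspace: "closed_csubspace E \<Longrightarrow> subspace E"
  by (auto simp: closed_csubspace_def subspace_def scaleR_scaleC)

lemma closed_csubspace_scaleC: "closed_csubspace E \<Longrightarrow> x \<in> E \<Longrightarrow> a *\<^sub>C x \<in> E"
  by (simp add: closed_csubspace_def)

lemma closed_csubspace_UNIV [simp]: "closed_csubspace UNIV"
  by (simp add: closed_csubspace_def)

section \<open>Approximate Riesz representation for semi-inner products\<close>

text \<open>This is the discriminant condition for a nonnegative quadratic in \<open>t\<close>, kept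
  valid when the leading coefficient vanishes.\<close>

lemma quadratic_nonneg_imp_abs_le:
  fixes b c e :: real
  assumes "0 \<le> e" "0 \<le> c" and nonneg: "\<And>t. 0 \<le> e\<^sup>2 + 2 * t * b + t\<^sup>2 * c"
  shows "\<bar>b\<bar> \<le> e * sqrt c"
proof (cases "c = 0")
  case True
  show ?thesis
  proof (rule ccontr)
    assume "\<not> \<bar>b\<bar> \<le> e * sqrt c"
    then have "b \<noteq> 0" using True by simp
    \<comment> \<open>With \<open>c = 0\<close> this value of \<open>t\<close> makes the quadratic
      equal to \<open>-1\<close>.\<close>
    then show False
      using nonneg[of "- (e\<^sup>2 + 1) / (2 * b)"] True by (simp add: field_simps)
  qed
next
  case False
  then have "c > 0" using assms by simp
  then have "b\<^sup>2 \<le> e\<^sup>2 * c"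
    using nonneg[of "- b / c"] by (simp add: field_simps power2_eq_square)
  also have "\<dots> = (e * sqrt c)\<^sup>2" using \<open>c > 0\<close> by (simp add: power_mult_distrib)
  finally show ?thesis
    using assms by (simp add: abs_le_square_iff[symmetric])
qed

locale semi_inner =
  fixes R :: "'a::real_vector set" and s :: "'a \<Rightarrow> 'a \<Rightarrow> real"
  assumes R: "subspace R"
    and s_add: "x \<in> R \<Longrightarrow> y \<in> R \<Longrightarrow> z \<in> R \<Longrightarrow> s (x + y) z = s x z + s y z"
    and s_scaleR: "x \<in> R \<Longrightarrow> z \<in> R \<Longrightarrow> s (r *\<^sub>R x) z = r * s x z"
    and s_commute: "x \<in> R \<Longrightarrow> y \<in> R \<Longrightarrow> s x y = s y x"
    and s_nonneg: "x \<in> R \<Longrightarrow> 0 \<le> s x x"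
begin

lemma s_diff: "x \<in> R \<Longrightarrow> y \<in> R \<Longrightarrow> z \<in> R \<Longrightarrow> s (x - y) z = s x z - s y z"
  using s_add[of "x - y" y z] by (simp add: subspace_diff[OF R])

lemma s_expand:
  assumes "u \<in> R" "r \<in> R"
  shows "s (u + t *\<^sub>R r) (u + t *\<^sub>R r) = s u u + 2 * t * s u r + t\<^sup>2 * s r r"
proof -
  note [simp] = subspace_add[OF R] subspace_scale[OF R] assms
  have *: "s (u + t *\<^sub>R r) z = s u z + t * s r z" if "z \<in> R" for z
    using that by (simp add: s_add s_scaleR)
  let ?z = "u + t *\<^sub>R r"
  have "s ?z ?z = s ?z u + t * s ?z r"
    using *[of ?z] s_commute[of ?z u] s_commute[of ?z r] by simp
  also have "\<dots> = s u u + 2 * t * s u r + t\<^sup>2 * s r r"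
    unfolding *[OF assms(1)] *[OF assms(2)] s_commute[OF assms(2,1)]
    by (simp add: power2_eq_square algebra_simps)
  finally show ?thesis .
qed

lemma Cauchy_Schwarz:
  assumes "u \<in> R" "r \<in> R"
  shows "\<bar>s u r\<bar> \<le> sqrt (s u u) * sqrt (s r r)"
proof (rule quadratic_nonneg_imp_abs_le)
  fix t
  show "0 \<le> (sqrt (s u u))\<^sup>2 + 2 * t * s u r + t\<^sup>2 * s r r"
    using s_nonneg[of "u + t *\<^sub>R r"] assms
    by (simp add: s_expand s_nonneg subspace_add[OF R] subspace_scale[OF R])
qed (use assms s_nonneg in auto)

text \<open>A near-minimiser of \<open>u \<mapsto> s u u - 2 * \<phi> u\<close> represents \<open>\<phi>\<close> up to \<open>e\<close>.\<close>

lemma approximate_Riesz: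
  assumes add: "\<And>x y. x \<in> R \<Longrightarrow> y \<in> R \<Longrightarrow> \<phi> (x + y) = \<phi> x + \<phi> y"
    and scale: "\<And>r x. x \<in> R \<Longrightarrow> \<phi> (r *\<^sub>R x) = r * \<phi> x"
    and bound: "\<And>r. r \<in> R \<Longrightarrow> \<bar>\<phi> r\<bar> \<le> C * sqrt (s r r)"
    and "e > (0::real)"
  shows "\<exists>u\<in>R. \<forall>r\<in>R. \<bar>\<phi> r - s u r\<bar> \<le> e * sqrt (s r r)"
proof -
  define J where "J u = s u u - 2 * \<phi> u" for u
  \<comment> \<open>Completing the square in \<open>sqrt (s u u)\<close> bounds \<open>J\<close>
    below, so its infimum is finite.\<close>
  have lower: "- C\<^sup>2 \<le> J u" if "u \<in> R" for u
  proof -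
    have "0 \<le> (sqrt (s u u) - C)\<^sup>2" by simp
    also have "\<dots> = s u u - 2 * (C * sqrt (s u u)) + C\<^sup>2"
      using s_nonneg[OF that] by (simp add: power2_diff)
    also have "\<dots> \<le> J u + C\<^sup>2" using bound[OF that] by (simp add: J_def)
    finally show ?thesis by simp
  qed
  then have bdd: "bdd_below (J ` R)" by (auto intro!: bdd_belowI)
  have "R \<noteq> {}" using subspace_0[OF R] by auto
  then have "\<exists>u\<in>R. J u < Inf (J ` R) + e\<^sup>2"
    using cInf_lessD[of "J ` R" "Inf (J ` R) + e\<^sup>2"] \<open>e > 0\<close> by auto
  then obtain u where u: "u \<in> R" "J u < Inf (J ` R) + e\<^sup>2" by auto
  have "\<bar>s u r - \<phi> r\<bar> \<le> e * sqrt (s r r)" if r: "r \<in> R" for r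
  proof (rule quadratic_nonneg_imp_abs_le)
    fix t
    have "u + t *\<^sub>R r \<in> R" using u r by (simp add: subspace_add[OF R] subspace_scale[OF R])
    \<comment> \<open>Near-minimality along the direction \<open>r\<close> is a quadratic inequality
      in \<open>t\<close> whose linear coefficient is twice the representation error.\<close>
    then have "J u \<le> J (u + t *\<^sub>R r) + e\<^sup>2"
      using u cInf_lower[OF _ bdd, of "J (u + t *\<^sub>R r)"] by fastforce
    then show "0 \<le> e\<^sup>2 + 2 * t * (s u r - \<phi> r) + t\<^sup>2 * s r r"
      using u r by (simp add: J_def s_expand add scale subspace_scale[OF R] algebra_simps)
  qed (use s_nonneg[OF r] \<open>e > 0\<close> in auto)
  then show ?thesis using u by (auto simp: abs_minus_commute)
qed

text \<open>Later estimates bound \<open>s u u\<close> by a multiple of its own root; dividing by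
  that root, unless it is zero, extracts the bound.\<close>

lemma sqrt_le_if_bound:
  assumes "u \<in> R" "0 \<le> e" "s u u \<le> e * sqrt (s u u)"
  shows "sqrt (s u u) \<le> e"
proof (cases "s u u = 0")
  case False
  then have pos: "sqrt (s u u) > 0" using s_nonneg[OF assms(1)] by simp
  have "sqrt (s u u) * sqrt (s u u) \<le> e * sqrt (s u u)" using assms s_nonneg[of u] by simp
  then show ?thesis using pos by (rule mult_right_le_imp_le)
qed (use assms in auto)

end

section \<open>Orthogonal projections and adjoints\<close>

lemma le_inverse_Suc_imp_Cauchy:
  fixes f :: "nat \<Rightarrow> 'a::metric_space"
  assumes "\<And>k l. dist (f k) (f l) \<le> inverse (Suc k) + inverse (Suc l)"
  shows "Cauchy f"
proof (rule metric_CauchyI)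
  fix e :: real assume "e > 0"
  then obtain N where N: "inverse (Suc N) < e / 2"
    using reals_Archimedean[of "e / 2"] by auto
  have "dist (f k) (f l) < e" if "k \<ge> N" "l \<ge> N" for k l
  proof -
    have "inverse (real (Suc j)) \<le> inverse (Suc N)" if "j \<ge> N" for j
      using that by (simp add: field_simps)
    from this[OF that(1)] this[OF that(2)] show ?thesis
      using assms[of k l] N by linarith
  qed
  then show "\<exists>M. \<forall>m\<ge>M. \<forall>n\<ge>M. dist (f m) (f n) < e" by blast
qed

text \<open>Approximate representers of precision \<open>inverse (Suc k)\<close> form a Cauchy
  sequence: testing two of them against their difference bounds it by the sum of the precisions. The
  limit stays in the closed \<open>E\<close> and represents exactly.\<close>

lemma Riesz_representation:
  fixes E :: "'a::complex_hilbert set"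
  assumes E: "closed_csubspace E"
    and add: "\<And>x y. x \<in> E \<Longrightarrow> y \<in> E \<Longrightarrow> \<phi> (x + y) = \<phi> x + \<phi> y"
    and scale: "\<And>r x. x \<in> E \<Longrightarrow> \<phi> (r *\<^sub>R x) = r * \<phi> x"
    and bound: "\<And>r. r \<in> E \<Longrightarrow> \<bar>\<phi> r\<bar> \<le> C * norm r"
  shows "\<exists>p\<in>E. \<forall>r\<in>E. \<phi> r = inner p r"
proof -
  note sub = closed_csubspace_subspace[OF E]
  interpret semi_inner E inner
    by unfold_locales (auto simp: sub inner_add_left intro: inner_commute)
  have "\<exists>u\<in>E. \<forall>r\<in>E. \<bar>\<phi> r - inner u r\<bar> \<le> inverse (Suc k) * norm r" for k
    unfolding norm_eq_sqrt_inner
    by (rule approximate_Riesz[where C = C]) (use add scale bound in \<open>auto simp: norm_eq_sqrt_inner\<close>)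
  then obtain u where u: "\<And>k. u k \<in> E"
    "\<And>k r. r \<in> E \<Longrightarrow> \<bar>\<phi> r - inner (u k) r\<bar> \<le> inverse (Suc k) * norm r"
    by metis
  have "norm (u k - u l) \<le> inverse (Suc k) + inverse (Suc l)" for k l
    unfolding norm_eq_sqrt_inner
  proof (rule sqrt_le_if_bound)
    have d: "u k - u l \<in> E" using u(1) sub by (simp add: subspace_diff)
    have "inner (u k - u l) (u k - u l) =
      (\<phi> (u k - u l) - inner (u l) (u k - u l)) - (\<phi> (u k - u l) - inner (u k) (u k - u l))"
      by (simp add: inner_diff_left)
    also have "\<dots> \<le> (inverse (Suc k) + inverse (Suc l)) * norm (u k - u l)"
      using u(2)[OF d, of k] u(2)[OF d, of l] by (simp add: distrib_right)
    finally show "inner (u k - u l) (u k - u l) \<le>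
      (inverse (Suc k) + inverse (Suc l)) * sqrt (inner (u k - u l) (u k - u l))"
      by (simp add: norm_eq_sqrt_inner)
  qed (use u sub in \<open>auto simp: subspace_diff\<close>)
  then have "Cauchy u" by (intro le_inverse_Suc_imp_Cauchy) (simp only: dist_norm)
  then obtain p where p: "u \<longlonglongrightarrow> p" by (auto simp: Cauchy_convergent_iff convergent_def)
  have "p \<in> E" using E u(1) p closed_sequentially[of E u p] by (simp add: closed_csubspace_def)
  moreover have "\<phi> r = inner p r" if r: "r \<in> E" for r
  proof -
    have "(\<lambda>k. inverse (Suc k) * norm r) \<longlonglongrightarrow> 0 * norm r"
      by (intro tendsto_intros LIMSEQ_inverse_real_of_nat)
    moreover have "(\<lambda>k. \<bar>\<phi> r - inner (u k) r\<bar>) \<longlonglongrightarrow> \<bar>\<phi> r - inner p r\<bar>"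
      by (intro tendsto_intros p)
    ultimately have "\<bar>\<phi> r - inner p r\<bar> \<le> 0 * norm r"
      using u(2)[OF r] by (intro LIMSEQ_le[of "\<lambda>k. \<bar>\<phi> r - inner (u k) r\<bar>"]) auto
    then show ?thesis by simp
  qed
  ultimately show ?thesis by blast
qed

lemma cinner_eqI:
  assumes "closed_csubspace E" "\<And>y. y \<in> E \<Longrightarrow> inner x y = inner x' y" "y \<in> E"
  shows "cinner x y = cinner x' y"
  using assms closed_csubspace_scaleC[OF assms(1,3), of \<i>] by (simp add: cinner_eq_inner)

lemma inner_ext_on:
  assumes "subspace E" "p \<in> E" "p' \<in> E" "\<And>y. y \<in> E \<Longrightarrow> inner p y = inner p' y"
  shows "p = p'"
proof -
  have "inner (p - p') (p - p') = 0"
    using assms(4)[of "p - p'"] assms(1-3) by (simp add: inner_diff_left subspace_diff)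
  then show ?thesis by simp
qed

lemma proj_on_ex1:
  assumes E: "closed_csubspace E"
  shows "\<exists>!p. p \<in> E \<and> (\<forall>y\<in>E. cinner (x - p) y = 0)"
proof -
  have "\<exists>p\<in>E. \<forall>r\<in>E. inner x r = inner p r"
    by (rule Riesz_representation[OF E, where C = "norm x"])
      (auto simp: inner_add_right Cauchy_Schwarz_ineq2)
  then obtain p where p: "p \<in> E" "\<And>r. r \<in> E \<Longrightarrow> inner x r = inner p r" by blast
  have c0: "cinner 0 y = 0" for y :: 'a
    using cinner_scaleC_left[of 0 0 y] by simp
  show ?thesis
  proof (rule ex1I[of _ p])
    show "p \<in> E \<and> (\<forall>y\<in>E. cinner (x - p) y = 0)"
      using p cinner_eqI[OF E, of "x - p" 0] by (auto simp: inner_diff_left c0)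
    fix p' assume p': "p' \<in> E \<and> (\<forall>y\<in>E. cinner (x - p') y = 0)"
    show "p' = p"
    proof (rule inner_ext_on[OF closed_csubspace_subspace[OF E]])
      fix y assume y: "y \<in> E"
      have "inner (x - p') y = 0" using p' y by (simp add: inner_eq_Re_cinner)
      then show "inner p' y = inner p y" using p(2)[OF y] by (simp add: inner_diff_left)
    qed (use p p' in auto)
  qed
qed

lemma proj_on_in: "closed_csubspace E \<Longrightarrow> proj_on E x \<in> E"
  unfolding proj_on_def by (drule proj_on_ex1[of _ x], drule theI') simp

lemma inner_proj_on: "closed_csubspace E \<Longrightarrow> y \<in> E \<Longrightarrow> inner (proj_on E x) y = inner x y"
proof -
  assume E: "closed_csubspace E" and y: "y \<in> E"
  have "cinner (x - proj_on E x) y = 0"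
    using theI'[OF proj_on_ex1[OF E, of x]] y unfolding proj_on_def by auto
  then have "inner (x - proj_on E x) y = 0" by (simp add: inner_eq_Re_cinner)
  then show ?thesis by (simp add: inner_diff_left)
qed

lemma proj_on_unique:
  assumes "closed_csubspace E" "p \<in> E" "\<And>y. y \<in> E \<Longrightarrow> inner p y = inner x y"
  shows "proj_on E x = p"
  by (rule inner_ext_on[OF closed_csubspace_subspace]) (use assms in \<open>auto simp: proj_on_in inner_proj_on\<close>)

lemma proj_on_id: "closed_csubspace E \<Longrightarrow> x \<in> E \<Longrightarrow> proj_on E x = x"
  by (rule proj_on_unique) auto

lemma proj_on_linear:
  assumes E: "closed_csubspace E"
  shows "complex_linear (proj_on E)"
  unfolding complex_linear_def
proof safe
  note sub = closed_csubspace_subspace[OF E]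
  fix x y a
  show "proj_on E (x + y) = proj_on E x + proj_on E y"
    by (rule proj_on_unique[OF E])
      (auto simp: proj_on_in inner_proj_on E inner_add_left intro!: subspace_add[OF sub])
  show "proj_on E (a *\<^sub>C x) = a *\<^sub>C proj_on E x"
    by (rule proj_on_unique[OF E])
      (auto simp: inner_proj_on closed_csubspace_scaleC proj_on_in E inner_scaleC_left)
qed

lemma inner_proj_on_commute: "closed_csubspace E \<Longrightarrow> inner (proj_on E x) y = inner x (proj_on E y)"
  by (metis inner_commute inner_proj_on proj_on_in)

lemma norm_proj_on_le:
  assumes E: "closed_csubspace E"
  shows "norm (proj_on E x) \<le> norm x"
proof -
  have "(norm (proj_on E x))\<^sup>2 = inner x (proj_on E x)"
    by (simp add: power2_norm_eq_inner inner_proj_on proj_on_in E)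
  also have "\<dots> \<le> norm x * norm (proj_on E x)" by (rule norm_cauchy_schwarz)
  finally show ?thesis by (cases "proj_on E x = 0") (auto simp: power2_eq_square)
qed

section \<open>Bounded operators, adjoints and contractions\<close>

lemma bounded_opsD:
  assumes "A \<in> bounded_ops E F"
  shows "x \<in> E \<Longrightarrow> A x \<in> F" "x \<in> E \<Longrightarrow> y \<in> E \<Longrightarrow> A (x + y) = A x + A y"
    "x \<in> E \<Longrightarrow> A (a *\<^sub>C x) = a *\<^sub>C A x"
  using assms by (auto simp: bounded_ops_def)

lemma bounded_ops_UNIV_linear: "A \<in> bounded_ops UNIV UNIV \<Longrightarrow> complex_linear A"
  by (auto simp: bounded_ops_def complex_linear_def)

lemma adj_on_ex1:
  assumes E: "closed_csubspace E" and A: "A \<in> bounded_ops E F"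
  shows "\<exists>!y. y \<in> E \<and> (\<forall>x\<in>E. cinner (A x) h = cinner x y)"
proof -
  obtain C where C: "\<And>x. x \<in> E \<Longrightarrow> norm (A x) \<le> C * norm x"
    using A unfolding bounded_ops_def by blast
  have "\<exists>y\<in>E. \<forall>r\<in>E. inner (A r) h = inner y r"
  proof (rule Riesz_representation[OF E, where C = "C * norm h"])
    fix r assume "r \<in> E"
    have "\<bar>inner (A r) h\<bar> \<le> norm (A r) * norm h" by (rule Cauchy_Schwarz_ineq2)
    also have "\<dots> \<le> (C * norm r) * norm h" by (intro mult_right_mono C \<open>r \<in> E\<close>) simp
    finally show "\<bar>inner (A r) h\<bar> \<le> C * norm h * norm r" by (simp add: mult_ac)
  next
    fix r x assume "x \<in> E"
    then have "A (r *\<^sub>R x) = r *\<^sub>R A x" by (simp only: scaleR_scaleC bounded_opsD(3)[OF A])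
    then show "inner (A (r *\<^sub>R x)) h = r * inner (A x) h" by simp
  qed (simp add: bounded_opsD(2)[OF A] inner_add_left)
  then obtain y where y: "y \<in> E" "\<And>r. r \<in> E \<Longrightarrow> inner (A r) h = inner r y"
    by (auto simp: inner_commute)
  show ?thesis
  proof (rule ex1I[of _ y])
    have "cinner (A x) h = cinner x y" if x: "x \<in> E" for x
    proof -
      \<comment> \<open>The choices \<open>c = 1\<close> and \<open>c = \<i>\<close> yield the real
        and imaginary parts of the complex identity.\<close>
      have "Re (cinner (A (c *\<^sub>C x)) h) = Re (cinner (c *\<^sub>C x) y)" for c
        using y(2)[OF closed_csubspace_scaleC[OF E x, of c]] by (simp add: inner_eq_Re_cinner)
      from this[of 1] this[of \<i>] show ?thesis
        by (simp add: bounded_opsD(3)[OF A x] cinner_scaleC_left complex_eq_iff)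
    qed
    then show "y \<in> E \<and> (\<forall>x\<in>E. cinner (A x) h = cinner x y)" using y by blast
    fix y' assume y': "y' \<in> E \<and> (\<forall>x\<in>E. cinner (A x) h = cinner x y')"
    show "y' = y"
    proof (rule inner_ext_on[OF closed_csubspace_subspace[OF E]])
      fix x assume x: "x \<in> E"
      have "inner (A x) h = inner x y'" using y' x by (simp add: inner_eq_Re_cinner)
      then show "inner y' x = inner y x" using y(2)[OF x] by (simp add: inner_commute)
    qed (use y y' in auto)
  qed
qed

lemma adj_on_in: "closed_csubspace E \<Longrightarrow> A \<in> bounded_ops E F \<Longrightarrow> adj_on E A h \<in> E"
  and cinner_adj_on: "closed_csubspace E \<Longrightarrow> A \<in> bounded_ops E F \<Longrightarrow> x \<in> E \<Longrightarrow>
    cinner x (adj_on E A h) = cinner (A x) h"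
  unfolding adj_on_def using theI'[OF adj_on_ex1[of E A F h]] by auto

lemma inner_adj_on: "closed_csubspace E \<Longrightarrow> A \<in> bounded_ops E F \<Longrightarrow> x \<in> E \<Longrightarrow>
    inner x (adj_on E A h) = inner (A x) h"
  by (simp add: inner_eq_Re_cinner cinner_adj_on)

lemma adj_on_unique:
  assumes "closed_csubspace E" "A \<in> bounded_ops E F" "y \<in> E"
    "\<And>x. x \<in> E \<Longrightarrow> inner x y = inner (A x) h"
  shows "adj_on E A h = y"
  by (rule inner_ext_on[OF closed_csubspace_subspace])
    (use assms in \<open>auto simp: adj_on_in inner_adj_on inner_commute[of _ "_::'a"]\<close>)

lemma adj_on_UNIV_linear:
  assumes A: "A \<in> bounded_ops UNIV UNIV"
  shows "complex_linear (adj_on UNIV A)"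
  unfolding complex_linear_def
proof safe
  note A' = bounded_opsD[OF A]
  fix x y a
  show "adj_on UNIV A (x + y) = adj_on UNIV A x + adj_on UNIV A y"
    by (rule adj_on_unique[OF _ A]) (auto simp: inner_add_right inner_adj_on[OF _ A])
  show "adj_on UNIV A (a *\<^sub>C x) = a *\<^sub>C adj_on UNIV A x"
  proof (rule adj_on_unique[OF _ A])
    fix z
    show "inner z (a *\<^sub>C adj_on UNIV A x) = inner (A z) (a *\<^sub>C x)"
      using inner_adj_on[OF _ A, of "cnj a *\<^sub>C z" x] inner_scaleC_left[of "cnj a" z]
        inner_scaleC_left[of "cnj a" "A z"] by (simp add: A')
  qed auto
qed

lemma contractions_norm_le:
  assumes "A \<in> contractions E F" "x \<in> E"
  shows "norm (A x) \<le> norm x"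
proof (cases "x = 0")
  case True
  then show ?thesis
    using assms bounded_opsD(3)[of A E F x 0] scaleC_zero
    by (auto simp: contractions_def bounded_ops_def)
next
  case False
  obtain C where C: "\<And>x. x \<in> E \<Longrightarrow> norm (A x) \<le> C * norm x"
    using assms unfolding contractions_def bounded_ops_def by blast
  have "norm (A x) / norm x \<le> onorm_on E A"
    unfolding onorm_on_def
  proof (rule cSUP_upper[OF assms(2)])
    have "norm (A x) / norm x \<le> \<bar>C\<bar>" if "x \<in> E" for x
    proof (cases "x = 0")
      case False
      then have "norm (A x) / norm x \<le> C" using C[OF that] by (simp add: divide_le_eq)
      then show ?thesis by simp
    qed simp
    then show "bdd_above ((\<lambda>x. norm (A x) / norm x) ` E)" by (auto intro!: bdd_aboveI)
  qed
  also have "\<dots> \<le> 1" using assms(1) by (simp add: contractions_def)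
  finally show ?thesis using False by (simp add: divide_le_eq)
qed

lemma contractions_UNIVI:
  assumes "complex_linear B" "\<And>x. norm (B x) \<le> norm x"
  shows "B \<in> contractions UNIV UNIV"
proof -
  have "norm (B x) / norm x \<le> 1" for x
    using assms(2)[of x] by (cases "x = 0") auto
  then have "onorm_on UNIV B \<le> 1" unfolding onorm_on_def by (intro cSUP_least) auto
  moreover have "\<exists>C. \<forall>x. norm (B x) \<le> C * norm x" using assms(2) by (intro exI[of _ 1]) simp
  ultimately show ?thesis
    using assms(1) by (auto simp: contractions_def bounded_ops_def complex_linear_def)
qed

section \<open>Approximate intertwining for isometries with orthogonal ranges\<close>

lemma inner_sum_orthogonal:
  assumes "finite F" "\<And>i j x y. i \<in> F \<Longrightarrow> j \<in> F \<Longrightarrow> inner (V i x) (V j y) = (if i = j then inner x y else 0)"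
  shows "inner (\<Sum>i\<in>F. V i (f i)) (\<Sum>i\<in>F. V i (g i)) = (\<Sum>i\<in>F. inner (f i) (g i))"
proof -
  have "inner (\<Sum>i\<in>F. V i (f i)) (\<Sum>i\<in>F. V i (g i)) = (\<Sum>i\<in>F. \<Sum>j\<in>F. if i = j then inner (f i) (g i) else 0)"
    unfolding inner_sum_left inner_sum_right
    by (intro sum.cong refl) (simp add: assms(2))
  also have "\<dots> = (\<Sum>i\<in>F. inner (f i) (g i))"
    using assms(1) by (intro sum.cong refl) simp
  finally show ?thesis .
qed

lemma norm_sum_orthogonal:
  assumes "finite F" "\<And>i j x y. i \<in> F \<Longrightarrow> j \<in> F \<Longrightarrow> inner (V i x) (V j y) = (if i = j then inner x y else 0)"
  shows "(norm (\<Sum>i\<in>F. V i (f i)))\<^sup>2 = (\<Sum>i\<in>F. (norm (f i))\<^sup>2)"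
  using inner_sum_orthogonal[OF assms, of f f] by (simp add: power2_norm_eq_inner)

text \<open>The subspace is given by its projection \<open>P\<close>, the maps \<open>a i\<close>
  act as adjoints of the \<open>W i\<close>, and \<open>A\<close> is already extended to the whole
  domain. \<open>P_V\<close> says that the kernel of \<open>P\<close> is invariant under each
  \<open>V i\<close>, which expresses the lifting property without naming the compression. The
  commutator bound is stated for finite families, so that no infinite sums enter the
  construction.\<close>

locale lifting_data =
  fixes I :: "'i set" and V :: "'i \<Rightarrow> 'k::complex_hilbert \<Rightarrow> 'k"
    and W a :: "'i \<Rightarrow> 'x::complex_hilbert \<Rightarrow> 'x"
    and P :: "'k \<Rightarrow> 'k" and A :: "'x \<Rightarrow> 'k" and d :: real
  assumes V_linear: "i \<in> I \<Longrightarrow> complex_linear (V i)"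
    and W_linear: "i \<in> I \<Longrightarrow> complex_linear (W i)"
    and a_linear: "i \<in> I \<Longrightarrow> complex_linear (a i)"
    and V_inner: "i \<in> I \<Longrightarrow> j \<in> I \<Longrightarrow> inner (V i u) (V j v) = (if i = j then inner u v else 0)"
    and W_inner: "i \<in> I \<Longrightarrow> j \<in> I \<Longrightarrow> inner (W i x) (W j y) = (if i = j then inner x y else 0)"
    and a_W: "i \<in> I \<Longrightarrow> j \<in> I \<Longrightarrow> a i (W j x) = (if i = j then x else 0)"
    and P_linear: "complex_linear P"
    and P_inner: "inner (P u) v = inner u (P v)"
    and P_P: "P (P u) = P u"
    and P_V: "i \<in> I \<Longrightarrow> P (V i u) = P (V i (P u))"
    and A_linear: "complex_linear A"
    and P_A: "P (A x) = A x"
    and A_le: "norm (A x) \<le> norm x"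
    and d_nonneg: "0 \<le> d"
    and commutator_le: "finite F \<Longrightarrow> F \<subseteq> I \<Longrightarrow>
      norm (\<Sum>i\<in>F. P (V i (A (f i))) - A (W i (f i))) \<le> d * sqrt (\<Sum>i\<in>F. (norm (f i))\<^sup>2)"
begin

lemma P_le: "norm (P u) \<le> norm u"
proof -
  have "(norm (P u))\<^sup>2 = inner u (P u)" by (simp add: power2_norm_eq_inner P_inner P_P)
  also have "\<dots> \<le> norm u * norm (P u)" by (rule norm_cauchy_schwarz)
  finally show ?thesis by (cases "P u = 0") (auto simp: power2_eq_square)
qed

lemma tendsto_P: "(f \<longlongrightarrow> l) F \<Longrightarrow> ((\<lambda>x. P (f x)) \<longlongrightarrow> P l) F"
proof -
  have "bounded_linear P"
    using complex_linear_linear[OF P_linear] P_le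
    by (intro bounded_linear_intro[where K = 1]) (auto simp: linear_add linear_scale)
  then show "(f \<longlongrightarrow> l) F \<Longrightarrow> ((\<lambda>x. P (f x)) \<longlongrightarrow> P l) F" by (rule bounded_linear.tendsto)
qed

lemma pythagoras_P: "(norm u)\<^sup>2 = (norm (P u))\<^sup>2 + (norm (u - P u))\<^sup>2"
  by (simp add: power2_norm_eq_inner inner_diff_left inner_diff_right P_inner P_P)

lemma pythagoras_kernel:
  assumes "P u = u" "P v = 0"
  shows "(norm (u + v))\<^sup>2 = (norm u)\<^sup>2 + (norm v)\<^sup>2"
  using pythagoras_P[of "u + v"] assms by (simp add: complex_linear_simps[OF P_linear])

section \<open>Finite sums from the ranges of the \<open>W i\<close> and row operators on
  them\<close>

definition supp :: "'x \<Rightarrow> 'i set" where "supp z = {i\<in>I. a i z \<noteq> 0}"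

text \<open>Finitely supported families in \<open>'x\<close> are encoded by the algebraic sum \<open>R\<close> of the
  ranges of the isometries \<open>W i\<close>; \<open>M B\<close> is the row operator \<open>[V\<^sub>1 B, V\<^sub>2 B, \<dots>]\<close> on them.\<close>

definition R :: "'x set" where "R = {z. finite (supp z) \<and> z = (\<Sum>i\<in>supp z. W i (a i z))}"

definition M :: "('x \<Rightarrow> 'k) \<Rightarrow> 'x \<Rightarrow> 'k" where "M B z = (\<Sum>i\<in>supp z. V i (B (a i z)))"

lemma supp_subset: "supp z \<subseteq> I" by (auto simp: supp_def)

lemma M_eq:
  assumes "complex_linear B" "finite F" "F \<subseteq> I" "supp z \<subseteq> F"
  shows "M B z = (\<Sum>i\<in>F. V i (B (a i z)))"
  unfolding M_def
proof (rule sum.mono_neutral_left)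
  show "\<forall>i\<in>F - supp z. V i (B (a i z)) = 0"
    using assms by (auto simp: supp_def complex_linear_simps V_linear subset_iff)
qed (use assms in auto)

text \<open>Applying \<open>a i\<close> to the sum leaves the single summand \<open>y i\<close>, so
  a finite family is determined by its sum.\<close>

lemma R_I:
  assumes "finite F" "F \<subseteq> I" "z = (\<Sum>i\<in>F. W i (y i))"
  shows "z \<in> R" "supp z \<subseteq> F" "i \<in> F \<Longrightarrow> a i z = y i"
proof -
  have az: "a i z = (if i \<in> F then y i else 0)" if "i \<in> I" for i
  proof -
    have "a i z = (\<Sum>j\<in>F. if i = j then y j else 0)"
      unfolding assms(3) using that assms(2)
      by (auto simp: complex_linear_simps a_linear a_W subset_iff intro!: sum.cong)
    then show ?thesis using assms(1) by simp
  qed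
  show sub: "supp z \<subseteq> F" using az assms(2) by (auto simp: supp_def split: if_splits)
  show "i \<in> F \<Longrightarrow> a i z = y i" using az assms(2) by auto
  have "z = (\<Sum>i\<in>F. W i (a i z))" unfolding assms(3)
    using az assms(2,3) by (intro sum.cong) auto
  also have "\<dots> = (\<Sum>i\<in>supp z. W i (a i z))"
  proof (rule sum.mono_neutral_right)
    show "\<forall>i\<in>F - supp z. W i (a i z) = 0"
      using assms by (auto simp: supp_def complex_linear_simps W_linear subset_iff)
  qed (use assms sub in auto)
  finally show "z \<in> R" using finite_subset[OF sub assms(1)] by (simp add: R_def)
qed

lemma R_sum:
  assumes "z \<in> R" "finite F" "F \<subseteq> I" "supp z \<subseteq> F"
  shows "z = (\<Sum>i\<in>F. W i (a i z))"
proof -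
  have "z = (\<Sum>i\<in>supp z. W i (a i z))" using assms(1) by (simp add: R_def)
  also have "\<dots> = (\<Sum>i\<in>F. W i (a i z))"
  proof (rule sum.mono_neutral_left)
    show "\<forall>i\<in>F - supp z. W i (a i z) = 0"
      using assms by (auto simp: supp_def complex_linear_simps W_linear subset_iff)
  qed (use assms in auto)
  finally show ?thesis .
qed

lemma R_cases2:
  assumes "z \<in> R" "w \<in> R"
  obtains F where "finite F" "F \<subseteq> I" "supp z \<subseteq> F" "supp w \<subseteq> F"
    "z = (\<Sum>i\<in>F. W i (a i z))" "w = (\<Sum>i\<in>F. W i (a i w))"
proof
  show fin: "finite (supp z \<union> supp w)" using assms by (simp add: R_def)
  show sub: "supp z \<union> supp w \<subseteq> I" using supp_subset by auto
  show "z = (\<Sum>i\<in>supp z \<union> supp w. W i (a i z))" "w = (\<Sum>i\<in>supp z \<union> supp w. W i (a i w))"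
    using R_sum[OF _ fin sub] assms by auto
qed auto

lemma R_add: "z \<in> R \<Longrightarrow> w \<in> R \<Longrightarrow> z + w \<in> R"
  and supp_add: "supp z \<subseteq> F \<Longrightarrow> supp w \<subseteq> F \<Longrightarrow> supp (z + w) \<subseteq> F"
proof -
  show "supp z \<subseteq> F \<Longrightarrow> supp w \<subseteq> F \<Longrightarrow> supp (z + w) \<subseteq> F"
    by (force simp: supp_def complex_linear_simps a_linear)
  assume "z \<in> R" "w \<in> R"
  then obtain F where F: "finite F" "F \<subseteq> I" "z = (\<Sum>i\<in>F. W i (a i z))" "w = (\<Sum>i\<in>F. W i (a i w))"
    by (rule R_cases2)
  have "z + w = (\<Sum>i\<in>F. W i (a i z)) + (\<Sum>i\<in>F. W i (a i w))" using F(3,4) by simp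
  also have "\<dots> = (\<Sum>i\<in>F. W i (a i z + a i w))"
    using F(2) by (auto simp: sum.distrib[symmetric] complex_linear_simps W_linear subset_iff intro!: sum.cong)
  finally show "z + w \<in> R" by (rule R_I(1)[OF F(1,2)])
qed

lemma R_scaleC: "z \<in> R \<Longrightarrow> c *\<^sub>C z \<in> R"
  and supp_scaleC: "supp z \<subseteq> F \<Longrightarrow> supp (c *\<^sub>C z) \<subseteq> F"
proof -
  show "supp z \<subseteq> F \<Longrightarrow> supp (c *\<^sub>C z) \<subseteq> F"
    by (auto simp: supp_def complex_linear_simps a_linear)
  assume "z \<in> R"
  then have z: "finite (supp z)" "z = (\<Sum>i\<in>supp z. W i (a i z))" by (simp_all add: R_def)
  have "c *\<^sub>C z = c *\<^sub>C (\<Sum>i\<in>supp z. W i (a i z))" using z(2) by simp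
  also have "\<dots> = (\<Sum>i\<in>supp z. W i (c *\<^sub>C a i z))"
    unfolding scaleC_linear_simps using supp_subset[of z]
    by (auto simp: complex_linear_simps W_linear subset_iff intro!: sum.cong)
  finally show "c *\<^sub>C z \<in> R" by (rule R_I(1)[OF z(1) supp_subset])
qed

lemma subspace_R: "subspace R"
  using R_I(1)[of "{}" 0] by (auto simp: subspace_def R_add R_scaleC scaleR_scaleC)

lemma W_in_R: "i \<in> I \<Longrightarrow> W i x \<in> R"
  by (rule R_I(1)[of "{i}" _ "\<lambda>_. x"]) auto

lemma M_add:
  assumes B: "complex_linear B" and "z \<in> R" "w \<in> R"
  shows "M B (z + w) = M B z + M B w"
proof -
  obtain F where F: "finite F" "F \<subseteq> I" "supp z \<subseteq> F" "supp w \<subseteq> F"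
    using assms(2,3) by (rule R_cases2)
  show ?thesis
    unfolding M_eq[OF B F(1,2,3)] M_eq[OF B F(1,2,4)] M_eq[OF B F(1,2) supp_add[OF F(3,4)]]
    using F(2) by (auto simp: sum.distrib[symmetric] complex_linear_simps a_linear V_linear B subset_iff
      intro!: sum.cong)
qed

lemma M_scaleC:
  assumes B: "complex_linear B" and "z \<in> R"
  shows "M B (c *\<^sub>C z) = c *\<^sub>C M B z"
proof -
  have fin: "finite (supp z)" using assms by (simp add: R_def)
  show ?thesis
    unfolding M_eq[OF B fin supp_subset order.refl] M_eq[OF B fin supp_subset supp_scaleC[OF order.refl]]
      scaleC_linear_simps
    using supp_subset[of z]
    by (auto simp: complex_linear_simps a_linear V_linear B subset_iff intro!: sum.cong)
qed

lemma M_W: "complex_linear B \<Longrightarrow> i \<in> I \<Longrightarrow> M B (W i x) = V i (B x)"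
  using R_I(2)[of "{i}" "W i x" "\<lambda>_. x"] by (subst M_eq[of B "{i}"]) (auto simp: a_W)

text \<open>The rows of the \<open>V i\<close> and of the \<open>W i\<close> are both isometric on
  finite families, so contractivity of \<open>B\<close> can be applied coordinatewise.\<close>

lemma norm_M_le:
  assumes B: "complex_linear B" "\<And>x. norm (B x) \<le> norm x" and z: "z \<in> R"
  shows "norm (M B z) \<le> norm z"
proof (rule power2_le_imp_le)
  have fin: "finite (supp z)" and z': "z = (\<Sum>i\<in>supp z. W i (a i z))" using z by (simp_all add: R_def)
  have "(norm (M B z))\<^sup>2 = (\<Sum>i\<in>supp z. (norm (B (a i z)))\<^sup>2)"
    unfolding M_def by (rule norm_sum_orthogonal[OF fin V_inner]) (use supp_subset in blast)+
  also have "\<dots> \<le> (\<Sum>i\<in>supp z. (norm (a i z))\<^sup>2)"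
    by (intro sum_mono power_mono B(2)) simp
  also have "\<dots> = (norm (\<Sum>i\<in>supp z. W i (a i z)))\<^sup>2"
    by (rule norm_sum_orthogonal[OF fin W_inner, symmetric]) (use supp_subset in blast)+
  finally show "(norm (M B z))\<^sup>2 \<le> (norm z)\<^sup>2" using z' by simp
qed simp

lemma inner_M:
  assumes "complex_linear B" "complex_linear C" "z \<in> R" "w \<in> R"
  obtains F where "finite F" "F \<subseteq> I" "inner (M B z) (M C w) = (\<Sum>i\<in>F. inner (B (a i z)) (C (a i w)))"
proof -
  obtain F where F: "finite F" "F \<subseteq> I" "supp z \<subseteq> F" "supp w \<subseteq> F"
    using assms(3,4) by (rule R_cases2)
  have "inner (M B z) (M C w) = (\<Sum>i\<in>F. inner (B (a i z)) (C (a i w)))"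
    unfolding M_eq[OF assms(1) F(1,2,3)] M_eq[OF assms(2) F(1,2,4)]
    by (rule inner_sum_orthogonal[OF F(1) V_inner]) (use F(2) in blast)+
  with F(1,2) show thesis by (rule that)
qed

section \<open>The commutator and the defect forms\<close>

definition D :: "'x \<Rightarrow> 'k" where "D z = P (M A z) - A z"

lemma D_add: "z \<in> R \<Longrightarrow> w \<in> R \<Longrightarrow> D (z + w) = D z + D w"
  by (simp add: D_def M_add A_linear P_linear complex_linear_simps)

lemma D_scaleC: "z \<in> R \<Longrightarrow> D (c *\<^sub>C z) = c *\<^sub>C D z"
  by (simp add: D_def M_scaleC A_linear P_linear complex_linear_simps scaleC_linear_simps)

lemma P_D: "P (D z) = D z"
  by (simp add: D_def complex_linear_simps[OF P_linear] P_P P_A)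

text \<open>Expanding \<open>z\<close> into its coordinates shows that \<open>D z\<close> is the
  commutator row applied to them; orthogonal ranges turn their square sum into the norm of
  \<open>z\<close>.\<close>

lemma D_le:
  assumes z: "z \<in> R"
  shows "norm (D z) \<le> d * norm z"
proof -
  have fin: "finite (supp z)" and z': "z = (\<Sum>i\<in>supp z. W i (a i z))" using z by (simp_all add: R_def)
  have "A z = (\<Sum>i\<in>supp z. A (W i (a i z)))"
    by (subst z') (simp add: complex_linear_simps[OF A_linear])
  then have "D z = (\<Sum>i\<in>supp z. P (V i (A (a i z))) - A (W i (a i z)))"
    by (simp add: D_def M_def complex_linear_simps[OF P_linear] sum_subtractf)
  also have "norm \<dots> \<le> d * sqrt (\<Sum>i\<in>supp z. (norm (a i z))\<^sup>2)"
    by (rule commutator_le[OF fin supp_subset])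
  also have "(\<Sum>i\<in>supp z. (norm (a i z))\<^sup>2) = (norm (\<Sum>i\<in>supp z. W i (a i z)))\<^sup>2"
    by (rule norm_sum_orthogonal[OF fin W_inner, symmetric]) (use supp_subset in blast)+
  finally show ?thesis using z' by simp
qed

text \<open>One factor is estimated by the commutator bound, the other by contractivity. This makes
  the form \<open>s2\<close> below nonnegative.\<close>

lemma D_sq_le:
  assumes z: "z \<in> R"
  shows "(norm (D z))\<^sup>2 \<le> 2 * d * (norm z)\<^sup>2"
proof -
  have "norm (D z) \<le> norm (P (M A z)) + norm (A z)" unfolding D_def by (rule norm_triangle_ineq4)
  also have "\<dots> \<le> 2 * norm z"
    using P_le[of "M A z"] norm_M_le[OF A_linear A_le z] A_le[of z] by linarith
  finally have "norm (D z) * norm (D z) \<le> (d * norm z) * (2 * norm z)"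
    by (intro mult_mono D_le z) (auto simp: d_nonneg)
  then show ?thesis by (simp add: power2_eq_square mult_ac)
qed

text \<open>These are the forms of the operators \<open>1 - A^* A\<close> and
  \<open>2 d - D^* D\<close>. Their sum dominates \<open>N B\<close>, and the Douglas splitting
  distributes \<open>N B\<close> between the two.\<close>

definition s1 :: "'x \<Rightarrow> 'x \<Rightarrow> real" where "s1 x y = inner x y - inner (A x) (A y)"
definition s2 :: "'x \<Rightarrow> 'x \<Rightarrow> real" where "s2 x y = 2 * d * inner x y - inner (D x) (D y)"
definition s :: "'x \<Rightarrow> 'x \<Rightarrow> real" where "s x y = s1 x y + s2 x y"

lemma s1_add: "s1 (x + y) z = s1 x z + s1 y z"
  and s1_add_right: "s1 z (x + y) = s1 z x + s1 z y"
  and s1_scaleC: "s1 (c *\<^sub>C x) y = s1 x (cnj c *\<^sub>C y)"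
  and s1_scaleR: "s1 (r *\<^sub>R x) y = r * s1 x y"
  and s1_scaleR_right: "s1 x (r *\<^sub>R y) = r * s1 x y"
  and s1_commute: "s1 x y = s1 y x"
  and s1_self: "s1 x x = (norm x)\<^sup>2 - (norm (A x))\<^sup>2"
  and s1_nonneg: "0 \<le> s1 x x"
proof -
  show "s1 (c *\<^sub>C x) y = s1 x (cnj c *\<^sub>C y)"
    by (simp add: s1_def complex_linear_simps[OF A_linear] inner_scaleC_left)
qed (use A_le[of x] linear_scale[OF complex_linear_linear[OF A_linear]] in
    \<open>auto simp: s1_def complex_linear_simps[OF A_linear] inner_add_left inner_add_right
      power2_norm_eq_inner[symmetric] inner_commute algebra_simps power_mono\<close>)

lemma D_scaleR: "z \<in> R \<Longrightarrow> D (r *\<^sub>R z) = r *\<^sub>R D z"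
  by (simp add: scaleR_scaleC D_scaleC)

lemma s2_nonneg: "z \<in> R \<Longrightarrow> 0 \<le> s2 z z"
  using D_sq_le[of z] by (simp add: s2_def power2_norm_eq_inner)

lemma s2_scaleC: "z \<in> R \<Longrightarrow> w \<in> R \<Longrightarrow> s2 (c *\<^sub>C z) w = s2 z (cnj c *\<^sub>C w)"
  by (simp add: s2_def D_scaleC R_scaleC inner_scaleC_left)

sublocale S1: semi_inner UNIV s1
  by unfold_locales (auto simp: s1_add s1_scaleR s1_nonneg intro: s1_commute)

sublocale S2: semi_inner R s2
  by unfold_locales (auto simp: subspace_R s2_nonneg, auto simp: s2_def D_add D_scaleR inner_add_left
      algebra_simps inner_commute)

sublocale S: semi_inner R s
  by unfold_locales (auto simp: s_def subspace_R S2.s_add S1.s_add S2.s_scaleR S1.s_scaleR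
      S2.s_nonneg S1.s_nonneg distrib_left intro: arg_cong2[where f = "(+)"] S1.s_commute S2.s_commute)

lemma s_scaleC: "z \<in> R \<Longrightarrow> w \<in> R \<Longrightarrow> s (c *\<^sub>C z) w = s z (cnj c *\<^sub>C w)"
  by (simp add: s_def s1_scaleC s2_scaleC)

lemma s_scaleC_self:
  assumes "z \<in> R"
  shows "s (c *\<^sub>C z) (c *\<^sub>C z) = (cmod c)\<^sup>2 * s z z"
proof -
  have "s (c *\<^sub>C z) (c *\<^sub>C z) = s z (complex_of_real ((cmod c)\<^sup>2) *\<^sub>C z)"
    by (simp only: s_scaleC R_scaleC assms scaleC_scaleC complex_norm_square mult.commute[of "cnj c"])
  also have "\<dots> = s z ((cmod c)\<^sup>2 *\<^sub>R z)" by (simp only: scaleR_scaleC)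
  also have "\<dots> = (cmod c)\<^sup>2 * s z z"
    using assms S.s_commute[of z "(cmod c)\<^sup>2 *\<^sub>R z"] by (simp add: S.s_scaleR subspace_scale[OF subspace_R])
  finally show ?thesis .
qed

lemma s1_le_s: "z \<in> R \<Longrightarrow> s1 z z \<le> s z z"
  and s2_le_s: "z \<in> R \<Longrightarrow> s2 z z \<le> s z z"
  using s1_nonneg s2_nonneg by (auto simp: s_def)

section \<open>Approximate representatives for the Douglas splitting\<close>

text \<open>An exact \<open>u\<close> would be the Riesz vector of the functional
  \<open>s1 x\<close> for the form \<open>s\<close>. For \<open>x\<close> in \<open>R\<close>, the
  vectors \<open>u\<close> and \<open>x - u\<close> are then the parts of \<open>x\<close> belonging
  to \<open>s1\<close> and \<open>s2\<close>.\<close>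

definition represents :: "real \<Rightarrow> 'x \<Rightarrow> 'x \<Rightarrow> bool" where
  "represents e u x \<longleftrightarrow> u \<in> R \<and> (\<forall>r\<in>R. \<bar>s1 x r - s u r\<bar> \<le> e * sqrt (s r r))"

text \<open>As \<open>s1\<close> is dominated by \<open>s\<close> on \<open>R\<close>,
  Cauchy-Schwarz for \<open>s1\<close> makes the functional \<open>s1 x\<close> bounded in the
  seminorm of \<open>s\<close>.\<close>

lemma represents_ex:
  assumes "e > 0" shows "\<exists>u. represents e u x"
proof -
  have "\<exists>u\<in>R. \<forall>r\<in>R. \<bar>s1 x r - s u r\<bar> \<le> e * sqrt (s r r)"
  proof (rule S.approximate_Riesz[where C = "sqrt (s1 x x)"])
    fix r assume r: "r \<in> R"
    have "\<bar>s1 x r\<bar> \<le> sqrt (s1 x x) * sqrt (s1 r r)" by (rule S1.Cauchy_Schwarz) auto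
    also have "\<dots> \<le> sqrt (s1 x x) * sqrt (s r r)"
      by (intro mult_left_mono) (auto simp: s1_le_s r s1_nonneg)
    finally show "\<bar>s1 x r\<bar> \<le> sqrt (s1 x x) * sqrt (s r r)" .
  qed (auto simp: s1_add_right s1_scaleR_right assms)
  then show ?thesis by (auto simp: represents_def)
qed

lemma represents_unique:
  assumes u: "represents e u x" and v: "represents f v x" and "0 \<le> e" "0 \<le> f"
  shows "sqrt (s (u - v) (u - v)) \<le> e + f"
proof (rule S.sqrt_le_if_bound)
  have uv: "u \<in> R" "v \<in> R" using u v by (auto simp: represents_def)
  then show w: "u - v \<in> R" by (simp add: subspace_diff[OF subspace_R])
  have "s (u - v) (u - v) = (s1 x (u - v) - s v (u - v)) - (s1 x (u - v) - s u (u - v))"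
    using S.s_diff[OF uv w] by simp
  also have "\<dots> \<le> (e + f) * sqrt (s (u - v) (u - v))"
    using u v w unfolding represents_def distrib_right by (smt (verit, best))
  finally show "s (u - v) (u - v) \<le> (e + f) * sqrt (s (u - v) (u - v))" .
qed (use assms in auto)

lemma represents_add:
  assumes "represents e u x" "represents f v y"
  shows "represents (e + f) (u + v) (x + y)"
  using assms unfolding represents_def
  by (auto simp: R_add s1_add S.s_add distrib_right) (smt (verit, best))

lemma represents_scaleC:
  assumes "represents e u x"
  shows "represents (cmod c * e) (c *\<^sub>C u) (c *\<^sub>C x)"
  unfolding represents_def
proof safe
  have u: "u \<in> R" using assms by (simp add: represents_def)
  then show "c *\<^sub>C u \<in> R" by (rule R_scaleC)
  fix r assume r: "r \<in> R"
  have "\<bar>s1 (c *\<^sub>C x) r - s (c *\<^sub>C u) r\<bar> = \<bar>s1 x (cnj c *\<^sub>C r) - s u (cnj c *\<^sub>C r)\<bar>"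
    using u r by (simp add: s_scaleC s1_scaleC)
  also have "\<dots> \<le> e * sqrt (s (cnj c *\<^sub>C r) (cnj c *\<^sub>C r))"
    using assms r by (simp add: represents_def R_scaleC)
  also have "\<dots> = cmod c * e * sqrt (s r r)"
    using r by (simp add: s_scaleC_self real_sqrt_mult)
  finally show "\<bar>s1 (c *\<^sub>C x) r - s (c *\<^sub>C u) r\<bar> \<le> cmod c * e * sqrt (s r r)" .
qed

definition rep :: "nat \<Rightarrow> 'x \<Rightarrow> 'x" where "rep k x = (SOME u. represents (inverse (Suc k)) u x)"

lemma rep: "represents (inverse (Suc k)) (rep k x) x"
  unfolding rep_def by (rule someI_ex[OF represents_ex]) simp

lemma rep_in_R [simp]: "rep k x \<in> R"
  using rep by (simp add: represents_def)

text \<open>The representation is tested at the representative itself, followed by Cauchy-Schwarz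
  for \<open>s1\<close>. In the limit this bounds the correction \<open>C\<close>.\<close>

lemma sqrt_s_rep_le: "sqrt (s (rep k x) (rep k x)) \<le> sqrt (s1 x x) + inverse (Suc k)"
proof (rule S.sqrt_le_if_bound)
  let ?u = "rep k x"
  have "s ?u ?u \<le> s1 x ?u + inverse (Suc k) * sqrt (s ?u ?u)"
    using rep[of k x] rep_in_R[of k x] unfolding represents_def by (smt (verit, best))
  also have "s1 x ?u \<le> sqrt (s1 x x) * sqrt (s1 ?u ?u)"
    using S1.Cauchy_Schwarz[of x ?u] by simp
  also have "\<dots> \<le> sqrt (s1 x x) * sqrt (s ?u ?u)"
    by (intro mult_left_mono) (auto simp: s1_le_s s1_nonneg)
  finally show "s ?u ?u \<le> (sqrt (s1 x x) + inverse (Suc k)) * sqrt (s ?u ?u)"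
    by (simp add: distrib_right)
qed (auto simp: s1_nonneg)

text \<open>Since \<open>s w - s1 w = s2 w\<close>, the vector \<open>w - rep k w\<close>
  approximately represents \<open>s2 w\<close>, and the previous argument applies with
  \<open>s2\<close> in place of \<open>s1\<close>.\<close>

lemma sqrt_s_rep_diff_le:
  assumes w: "w \<in> R"
  shows "sqrt (s (w - rep k w) (w - rep k w)) \<le> sqrt (s2 w w) + inverse (Suc k)"
proof (rule S.sqrt_le_if_bound)
  let ?v = "w - rep k w"
  show v: "?v \<in> R" using w by (simp add: subspace_diff[OF subspace_R])
  have "s ?v ?v = s2 w ?v + (s1 w ?v - s (rep k w) ?v)"
    using S.s_diff[OF w _ v, of "rep k w"] by (simp add: s_def)
  also have "\<dots> \<le> s2 w ?v + inverse (Suc k) * sqrt (s ?v ?v)"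
    using rep[of k w] v unfolding represents_def by (smt (verit, best))
  also have "s2 w ?v \<le> sqrt (s2 w w) * sqrt (s2 ?v ?v)"
    using S2.Cauchy_Schwarz[OF w v] by simp
  also have "\<dots> \<le> sqrt (s2 w w) * sqrt (s ?v ?v)"
    by (intro mult_left_mono) (auto simp: s2_le_s s2_nonneg v w)
  finally show "s ?v ?v \<le> (sqrt (s2 w w) + inverse (Suc k)) * sqrt (s ?v ?v)"
    by (simp add: distrib_right)
qed (auto simp: s2_nonneg w)

text \<open>As \<open>P (M B z)\<close> is the same for all extensions \<open>B\<close> of \<open>A\<close>, \<open>N B z\<close> is the component of \<open>M B z\<close>
  in the kernel of \<open>P\<close>.\<close>

definition N :: "('x \<Rightarrow> 'k) \<Rightarrow> 'x \<Rightarrow> 'k" where "N B z = M B z - P (M A z)"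

definition extension :: "('x \<Rightarrow> 'k) \<Rightarrow> bool" where
  "extension B \<longleftrightarrow> complex_linear B \<and> (\<forall>x. norm (B x) \<le> norm x) \<and> (\<forall>x. P (B x) = A x)"

lemma extension_A: "extension A"
  by (simp add: extension_def A_linear A_le P_A)

text \<open>By \<open>P_V\<close> the component of \<open>B (a i z)\<close> in the kernel of
  \<open>P\<close> is lost, and the remaining component is \<open>A (a i z)\<close>.\<close>

lemma P_M:
  assumes "extension B" shows "P (M B z) = P (M A z)"
proof -
  have "P (V i (B (a i z))) = P (V i (A (a i z)))" if "i \<in> I" for i
    using P_V[OF that, of "B (a i z)"] assms by (simp add: extension_def)
  then show ?thesis
    unfolding M_def complex_linear_simps[OF P_linear]
    using supp_subset by (intro sum.cong) auto
qed

lemma P_N: "extension B \<Longrightarrow> P (N B z) = 0"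
  by (simp add: N_def complex_linear_simps[OF P_linear] P_M P_P)

lemma N_add: "extension B \<Longrightarrow> z \<in> R \<Longrightarrow> w \<in> R \<Longrightarrow> N B (z + w) = N B z + N B w"
  by (simp add: N_def M_add A_linear extension_def complex_linear_simps[OF P_linear])

lemma N_scaleC: "extension B \<Longrightarrow> z \<in> R \<Longrightarrow> N B (c *\<^sub>C z) = c *\<^sub>C N B z"
  by (simp add: N_def M_scaleC A_linear extension_def complex_linear_simps[OF P_linear] scaleC_linear_simps)

lemma N_diff: "extension B \<Longrightarrow> z \<in> R \<Longrightarrow> w \<in> R \<Longrightarrow> N B (z - w) = N B z - N B w"
  using N_add[of B "z - w" w] by (simp add: subspace_diff[OF subspace_R])

text \<open>\<open>M B z\<close> is the orthogonal sum of \<open>D z + A z\<close> and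
  \<open>N B z\<close>, with norm at most that of \<open>z\<close>. The cross term of
  \<open>D z\<close> and \<open>A z\<close> has no sign and costs
  \<open>2 * d * (norm z)\<^sup>2\<close>; this is the origin of the constant.\<close>

lemma norm_N_le:
  assumes B: "extension B" and z: "z \<in> R"
  shows "norm (N B z) \<le> sqrt (s z z)"
proof (rule real_le_rsqrt)
  have "(norm (M B z))\<^sup>2 = (norm (D z + A z))\<^sup>2 + (norm (N B z))\<^sup>2"
    using pythagoras_P[of "M B z"] by (simp add: P_M[OF B] N_def D_def)
  moreover have "(norm (M B z))\<^sup>2 \<le> (norm z)\<^sup>2"
    using B by (intro power_mono norm_M_le z) (auto simp: extension_def)
  moreover have "(norm (D z + A z))\<^sup>2 = (norm (D z))\<^sup>2 + (norm (A z))\<^sup>2 + 2 * inner (D z) (A z)"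
    by (simp add: power2_norm_eq_inner inner_add_left inner_add_right inner_commute)
  moreover have "- inner (D z) (A z) \<le> d * (norm z)\<^sup>2"
  proof -
    have "- inner (D z) (A z) \<le> norm (D z) * norm (A z)"
      using Cauchy_Schwarz_ineq2[of "D z" "A z"] by linarith
    also have "\<dots> \<le> (d * norm z) * norm z"
      by (intro mult_mono D_le z A_le) (auto simp: d_nonneg)
    finally show ?thesis by (simp add: power2_eq_square mult_ac)
  qed
  ultimately show "(norm (N B z))\<^sup>2 \<le> s z z"
    by (simp add: s_def s1_self s2_def power2_norm_eq_inner)
qed

section \<open>One step of the iteration\<close>

text \<open>This is the map \<open>A + C\<close>. The limit exists for extensions \<open>B\<close>,
  because representatives are Cauchy in the seminorm of \<open>s\<close>, which bounds
  \<open>N B\<close>.\<close>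

definition step :: "('x \<Rightarrow> 'k) \<Rightarrow> 'x \<Rightarrow> 'k" where "step B x = A x + lim (\<lambda>k. N B (rep k x))"

lemma LIMSEQ_inverse_Suc: "(\<lambda>k. c * inverse (real (Suc k))) \<longlonglongrightarrow> 0"
  using tendsto_mult_right_zero[OF LIMSEQ_inverse_real_of_nat] .

text \<open>All approximate representatives of \<open>x\<close> give the same limit; this makes \<open>step B\<close> linear.\<close>

lemma N_tendsto_step:
  assumes B: "extension B" and u: "\<And>k. represents (c * inverse (Suc k)) (u k) x" and c: "0 \<le> c"
  shows "(\<lambda>k. N B (u k)) \<longlonglongrightarrow> step B x - A x"
proof -
  have diff: "norm (N B v - N B w) \<le> e + f"
    if "represents e v x" "represents f w x" "0 \<le> e" "0 \<le> f" for v w e f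
  proof -
    have vw: "v \<in> R" "w \<in> R" using that by (auto simp: represents_def)
    have "norm (N B v - N B w) \<le> sqrt (s (v - w) (v - w))"
      using norm_N_le[OF B, of "v - w"] vw by (simp add: N_diff[OF B] subspace_diff[OF subspace_R])
    also have "\<dots> \<le> e + f" using that by (rule represents_unique)
    finally show ?thesis .
  qed
  have "Cauchy (\<lambda>k. N B (rep k x))"
    by (rule le_inverse_Suc_imp_Cauchy) (auto simp: dist_norm intro!: diff rep simp del: of_nat_Suc)
  then have lim: "(\<lambda>k. N B (rep k x)) \<longlonglongrightarrow> step B x - A x"
    by (simp add: step_def Cauchy_convergent_iff convergent_LIMSEQ_iff)
  moreover have "(\<lambda>k. N B (u k) - N B (rep k x)) \<longlonglongrightarrow> 0"
  proof (rule Lim_null_comparison[OF _ LIMSEQ_inverse_Suc[of "c + 1"]])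
    have "norm (N B (u k) - N B (rep k x)) \<le> c * inverse (Suc k) + inverse (Suc k)" for k
      by (rule diff[OF u rep]) (use c in auto)
    then show "\<forall>\<^sub>F k in sequentially. norm (N B (u k) - N B (rep k x)) \<le> (c + 1) * inverse (Suc k)"
      by (simp add: distrib_right)
  qed
  ultimately show ?thesis using tendsto_add by fastforce
qed

lemma N_rep_tendsto: "extension B \<Longrightarrow> (\<lambda>k. N B (rep k x)) \<longlonglongrightarrow> step B x - A x"
  by (rule N_tendsto_step[where c = 1]) (use rep in auto)

lemma P_step_diff:
  assumes B: "extension B" shows "P (step B x - A x) = 0"
proof -
  have "(\<lambda>k. P (N B (rep k x))) \<longlonglongrightarrow> P (step B x - A x)"
    by (intro tendsto_P N_rep_tendsto B)
  then show ?thesis by (simp add: P_N[OF B] LIMSEQ_const_iff)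
qed

lemma P_step: "extension B \<Longrightarrow> P (step B x) = A x"
  using P_step_diff[of B x] by (simp add: complex_linear_simps[OF P_linear] P_A)

lemma step_linear:
  assumes B: "extension B" shows "complex_linear (step B)"
  unfolding complex_linear_def
proof safe
  fix x y c
  \<comment> \<open>The errors of two representatives add up, hence the factor 2.\<close>
  have "(\<lambda>k. N B (rep k x + rep k y)) \<longlonglongrightarrow> step B (x + y) - A (x + y)"
  proof (rule N_tendsto_step[OF B, where c = 2])
    show "represents (2 * inverse (real (Suc k))) (rep k x + rep k y) (x + y)" for k
      using represents_add[OF rep[of k x] rep[of k y]] by (simp only: mult_2)
  qed simp
  moreover have "(\<lambda>k. N B (rep k x + rep k y)) \<longlonglongrightarrow> (step B x - A x) + (step B y - A y)"
    unfolding N_add[OF B rep_in_R rep_in_R] by (intro tendsto_add N_rep_tendsto B)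
  ultimately have "step B (x + y) - A (x + y) = (step B x - A x) + (step B y - A y)"
    by (rule LIMSEQ_unique)
  then show "step B (x + y) = step B x + step B y"
    by (simp add: complex_linear_simps[OF A_linear] algebra_simps)
  have "(\<lambda>k. N B (c *\<^sub>C rep k x)) \<longlonglongrightarrow> step B (c *\<^sub>C x) - A (c *\<^sub>C x)"
    by (rule N_tendsto_step[OF B, where c = "cmod c", OF represents_scaleC[OF rep]]) simp
  moreover have "(\<lambda>k. N B (c *\<^sub>C rep k x)) \<longlonglongrightarrow> c *\<^sub>C (step B x - A x)"
    unfolding N_scaleC[OF B rep_in_R] by (intro tendsto_scaleC N_rep_tendsto B)
  ultimately have "step B (c *\<^sub>C x) - A (c *\<^sub>C x) = c *\<^sub>C (step B x - A x)"
    by (rule LIMSEQ_unique)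
  then show "step B (c *\<^sub>C x) = c *\<^sub>C step B x"
    by (simp add: complex_linear_simps[OF A_linear] scaleC_linear_simps)
qed

lemma norm_step_diff_le:
  assumes B: "extension B" shows "norm (step B x - A x) \<le> sqrt (s1 x x)"
proof -
  have "norm (N B (rep k x)) \<le> sqrt (s1 x x) + 1 * inverse (Suc k)" for k
    using norm_N_le[OF B rep_in_R, of k x] sqrt_s_rep_le[of k x] by simp
  moreover have "(\<lambda>k. sqrt (s1 x x) + 1 * inverse (Suc k)) \<longlonglongrightarrow> sqrt (s1 x x) + 0"
    by (intro tendsto_intros LIMSEQ_inverse_Suc)
  ultimately show ?thesis
    using LIMSEQ_le[OF tendsto_norm[OF N_rep_tendsto[OF B]]] by fastforce
qed

text \<open>The correction is orthogonal to \<open>A x\<close>, and its squared norm is at most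
  \<open>s1 x x\<close>, exactly the room that \<open>A x\<close> leaves below
  \<open>(norm x)\<^sup>2\<close>.\<close>

lemma extension_step:
  assumes B: "extension B" shows "extension (step B)"
  unfolding extension_def
proof safe
  fix x
  have "(norm (A x + (step B x - A x)))\<^sup>2 = (norm (A x))\<^sup>2 + (norm (step B x - A x))\<^sup>2"
    by (intro pythagoras_kernel P_A P_step_diff B)
  also have "(norm (step B x - A x))\<^sup>2 \<le> (sqrt (s1 x x))\<^sup>2"
    by (intro power_mono norm_step_diff_le B) simp
  finally have "(norm (step B x))\<^sup>2 \<le> (norm x)\<^sup>2" by (simp add: s1_nonneg) (simp add: s1_self)
  then show "norm (step B x) \<le> norm x" by (rule power2_le_imp_le) simp
qed (use step_linear P_step B in auto)

text \<open>The difference is the orthogonal sum of \<open>- D w\<close> and a vector in the kernel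
  of \<open>P\<close> of squared norm at most \<open>s2 w w\<close>. The negative term in
  \<open>s2\<close> cancels the contribution of \<open>D w\<close>.\<close>

lemma norm_step_M_le:
  assumes B: "extension B" and w: "w \<in> R"
  shows "norm (step B w - M B w) \<le> sqrt (2 * d) * norm w"
proof -
  let ?e = "step B w - A w - N B w"
  \<comment> \<open>\<open>?e\<close> is the limit of \<open>N B (rep k w - w)\<close>, and the
    seminorm of \<open>s\<close> bounds \<open>N B\<close>.\<close>
  have "norm ?e \<le> sqrt (s2 w w)"
  proof -
    have "norm (N B (rep k w) - N B w) \<le> sqrt (s2 w w) + 1 * inverse (Suc k)" for k
      using norm_N_le[OF B, of "w - rep k w"] sqrt_s_rep_diff_le[OF w, of k]
      by (simp add: N_diff[OF B] w subspace_diff[OF subspace_R] norm_minus_commute)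
    moreover have "(\<lambda>k. sqrt (s2 w w) + 1 * inverse (Suc k)) \<longlonglongrightarrow> sqrt (s2 w w) + 0"
      by (intro tendsto_intros LIMSEQ_inverse_Suc)
    moreover have "(\<lambda>k. norm (N B (rep k w) - N B w)) \<longlonglongrightarrow> norm ?e"
      by (intro tendsto_intros N_rep_tendsto B)
    ultimately show ?thesis using LIMSEQ_le by fastforce
  qed
  then have "(norm ?e)\<^sup>2 \<le> (sqrt (s2 w w))\<^sup>2" by (intro power_mono) auto
  then have e: "(norm ?e)\<^sup>2 \<le> 2 * d * (norm w)\<^sup>2 - (norm (D w))\<^sup>2"
    by (simp add: s2_nonneg w) (simp add: s2_def power2_norm_eq_inner)
  have eq: "step B w - M B w = - D w + ?e" by (simp add: N_def D_def)
  have "(norm (- D w + ?e))\<^sup>2 = (norm (- D w))\<^sup>2 + (norm ?e)\<^sup>2"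
  proof (rule pythagoras_kernel)
    show "P (- D w) = - D w"
      by (simp only: linear_neg[OF complex_linear_linear[OF P_linear]] P_D)
    show "P ?e = 0"
      by (simp only: complex_linear_simps(2)[OF P_linear] P_step[OF B] P_A P_N[OF B] diff_self)
  qed
  then have "(norm (step B w - M B w))\<^sup>2 \<le> 2 * d * (norm w)\<^sup>2"
    using e unfolding eq norm_minus_cancel by linarith
  also have "\<dots> = (sqrt (2 * d) * norm w)\<^sup>2" using d_nonneg by (simp add: power_mult_distrib)
  finally show ?thesis by (rule power2_le_imp_le) (simp add: d_nonneg)
qed

section \<open>Convergence of the iteration\<close>

definition iter :: "nat \<Rightarrow> 'x \<Rightarrow> 'k" where "iter m = (step ^^ m) A"

lemma iter_0: "iter 0 = A" and iter_Suc: "iter (Suc m) = step (iter m)"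
  by (simp_all add: iter_def)

lemma extension_iter: "extension (iter m)"
  by (induction m) (simp_all add: iter_0 iter_Suc extension_A extension_step)

text \<open>The difference of the \<open>M\<close> terms lies in the kernel of \<open>P\<close>, so
  only the part \<open>M C w\<close> of \<open>N C w\<close> contributes; the orthogonal ranges of
  the \<open>V i\<close> then reduce the product to coordinates, where \<open>orth\<close>
  applies.\<close>

lemma inner_N_diff_eq_0:
  assumes ext: "extension B" "extension B'" "extension C" and R: "z \<in> R" "w \<in> R"
    and orth: "\<And>x y. inner (B' x - B x) (C y) = 0"
  shows "inner (N B' z - N B z) (N C w) = 0"
proof -
  let ?E = "\<lambda>x. B' x - B x"
  have lin: "complex_linear ?E" "complex_linear B" "complex_linear B'" "complex_linear C"
    using ext by (auto simp: extension_def complex_linear_def scaleC_linear_simps)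
  have ker: "P (M B' z - M B z) = 0"
    by (simp add: complex_linear_simps[OF P_linear] P_M ext)
  have "inner (N B' z - N B z) (N C w) = inner (M B' z - M B z) (M C w) - inner (M B' z - M B z) (P (M A w))"
    by (simp add: N_def inner_diff_right)
  also have "inner (M B' z - M B z) (P (M A w)) = 0"
    by (simp only: P_inner[symmetric] ker inner_zero_left)
  also have "M B' z - M B z = M ?E z"
    unfolding M_def sum_subtractf[symmetric] using supp_subset[of z]
    by (intro sum.cong) (auto simp: complex_linear_simps V_linear)
  also have "inner (M ?E z) (M C w) = 0"
  proof -
    obtain F where "inner (M ?E z) (M C w) = (\<Sum>i\<in>F. inner (?E (a i z)) (C (a i w)))"
      using inner_M[OF lin(1,4) R] by blast
    then show ?thesis by (simp add: orth)
  qed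
  finally show ?thesis by simp
qed

text \<open>The increments of the iteration are mutually orthogonal, as they lie in the ranges
  of words of different lengths in the \<open>V i\<close>.\<close>

lemma iter_increment_orthogonal:
  "j \<le> m \<Longrightarrow> inner (iter (Suc m) x - iter m x) (iter j y) = 0"
proof (induction m arbitrary: j x y)
  case 0
  then show ?case
    using P_inner[of "step A x - A x" "A y"] P_step_diff[OF extension_A, of x]
    by (simp add: iter_0 iter_Suc P_A)
next
  case (Suc m)
  have ker: "P (iter (Suc (Suc m)) x - iter (Suc m) x) = 0"
    using extension_iter[of "Suc (Suc m)"] extension_iter[of "Suc m"]
    by (simp add: extension_def complex_linear_simps[OF P_linear])
  have A0: "inner (iter (Suc (Suc m)) x - iter (Suc m) x) (A y) = 0"
    using P_inner[of "iter (Suc (Suc m)) x - iter (Suc m) x" "A y"] ker by (simp add: P_A)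
  show ?case
  proof (cases j)
    case 0
    then show ?thesis using A0 by (simp add: iter_0)
  next
    case (Suc l)
    \<comment> \<open>The induction hypothesis for \<open>m\<close> and \<open>l\<close> is carried
      through \<open>N\<close>; the limit over representatives raises both indices by one.\<close>
    have zero: "inner (N (iter (Suc m)) (rep k x) - N (iter m) (rep k x)) (N (iter l) (rep k y)) = 0" for k
      using Suc.prems Suc by (intro inner_N_diff_eq_0 extension_iter rep_in_R Suc.IH) simp
    have "(\<lambda>k. inner (N (iter (Suc m)) (rep k x) - N (iter m) (rep k x)) (N (iter l) (rep k y))) \<longlonglongrightarrow>
      inner ((step (iter (Suc m)) x - A x) - (step (iter m) x - A x)) (step (iter l) y - A y)"
      by (intro tendsto_intros N_rep_tendsto extension_iter)
    then have "inner (step (iter (Suc m)) x - step (iter m) x) (step (iter l) y - A y) = 0"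
      unfolding zero by (simp add: LIMSEQ_const_iff)
    then show ?thesis
      using A0 Suc by (simp add: iter_Suc inner_diff_right)
  qed
qed

text \<open>All increments from \<open>m\<close> up to \<open>k\<close> are orthogonal to
  \<open>iter m x\<close>, hence so is their sum, and Pythagoras applies.\<close>

lemma norm_iter_diff:
  assumes "m \<le> k"
  shows "(norm (iter k x - iter m x))\<^sup>2 = (norm (iter k x))\<^sup>2 - (norm (iter m x))\<^sup>2"
proof -
  have "inner (iter k x - iter m x) (iter m x) = 0"
    using assms
  proof (induction k rule: dec_induct)
    case (step k)
    have "inner (iter (Suc k) x - iter m x) (iter m x) =
      inner (iter (Suc k) x - iter k x) (iter m x) + inner (iter k x - iter m x) (iter m x)"
      by (simp add: inner_diff_left)
    then show ?case using step iter_increment_orthogonal[of m k x x] by simp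
  qed simp
  then show ?thesis
    by (simp add: power2_norm_eq_inner inner_diff_left inner_diff_right inner_commute)
qed

text \<open>The squared norms increase and stay below \<open>(norm x)\<^sup>2\<close>; the
  Pythagorean identity transfers their Cauchy property to the vectors.\<close>

lemma iter_convergent: "convergent (\<lambda>m. iter m x)"
proof -
  define b where "b m = (norm (iter m x))\<^sup>2" for m
  have "incseq b"
  proof (rule incseq_SucI)
    fix m
    show "b m \<le> b (Suc m)"
      using norm_iter_diff[of m "Suc m" x] zero_le_power2[of "norm (iter (Suc m) x - iter m x)"]
      by (simp add: b_def)
  qed
  moreover have "b m \<le> (norm x)\<^sup>2" for m
    unfolding b_def using extension_iter[of m] by (intro power_mono) (auto simp: extension_def)
  ultimately have "Cauchy b"
    using incseq_convergent by (metis LIMSEQ_imp_Cauchy)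
  have "Cauchy (\<lambda>m. iter m x)"
  proof (rule CauchyI')
    fix e :: real assume "e > 0"
    then obtain n0 where n0: "\<And>m k. m \<ge> n0 \<Longrightarrow> k \<ge> n0 \<Longrightarrow> norm (b m - b k) < e\<^sup>2"
      using CauchyD[OF \<open>Cauchy b\<close>, of "e\<^sup>2"] by auto
    have "norm (iter m x - iter k x) < e" if "m \<ge> n0" "m < k" for m k
    proof (rule power2_less_imp_less)
      have "(norm (iter m x - iter k x))\<^sup>2 = b k - b m"
        using norm_iter_diff[of m k x] that by (simp add: b_def norm_minus_commute)
      also have "\<dots> < e\<^sup>2" using n0[of k m] that by auto
      finally show "(norm (iter m x - iter k x))\<^sup>2 < e\<^sup>2" .
    qed (use \<open>e > 0\<close> in simp)
    then show "\<exists>M. \<forall>m\<ge>M. \<forall>n>m. dist (iter m x) (iter n x) < e" unfolding dist_norm by blast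
  qed
  then show ?thesis by (simp add: Cauchy_convergent_iff)
qed

theorem approximate_intertwiner:
  "\<exists>B. extension B \<and> (\<forall>i\<in>I. \<forall>x. norm (V i (B x) - B (W i x)) \<le> sqrt (2 * d) * norm x)"
proof -
  define B where "B x = lim (\<lambda>m. iter m x)" for x
  have B: "(\<lambda>m. iter m x) \<longlonglongrightarrow> B x" for x
    using iter_convergent[of x] by (simp add: B_def convergent_LIMSEQ_iff)
  note ext = extension_iter[unfolded extension_def complex_linear_def]
  have "extension B"
    unfolding extension_def complex_linear_def
  proof safe
    fix x y c
    have "(\<lambda>m. iter m x + iter m y) \<longlonglongrightarrow> B (x + y)" using B[of "x + y"] ext by simp
    then show "B (x + y) = B x + B y" by (rule LIMSEQ_unique) (intro tendsto_add B)
    have "(\<lambda>m. c *\<^sub>C iter m x) \<longlonglongrightarrow> B (c *\<^sub>C x)" using B[of "c *\<^sub>C x"] ext by simp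
    then show "B (c *\<^sub>C x) = c *\<^sub>C B x" by (rule LIMSEQ_unique) (intro tendsto_scaleC B)
    show "norm (B x) \<le> norm x"
      by (rule LIMSEQ_le_const2[OF tendsto_norm[OF B]]) (use ext in auto)
    have "(\<lambda>m. P (iter m x)) \<longlonglongrightarrow> P (B x)" by (intro tendsto_P B)
    then show "P (B x) = A x" using ext by (simp add: LIMSEQ_const_iff)
  qed
  moreover have "norm (V i (B x) - B (W i x)) \<le> sqrt (2 * d) * norm x" if i: "i \<in> I" for i x
  proof -
    have nV: "norm (V i u) = norm u" for u using V_inner[OF i i, of u u] by (simp add: norm_eq_sqrt_inner)
    have nW: "norm (W i x) = norm x" using W_inner[OF i i, of x x] by (simp add: norm_eq_sqrt_inner)
    have "bounded_linear (V i)"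
      using complex_linear_linear[OF V_linear[OF i]]
      by (intro bounded_linear_intro[where K = 1]) (auto simp: nV linear_add linear_scale)
    then have V: "(\<lambda>m. V i (iter m x)) \<longlonglongrightarrow> V i (B x)" using B by (rule bounded_linear.tendsto)
    \<comment> \<open>On \<open>W i x\<close> the row operator returns
      \<open>V i (iter m x)\<close>, so the one-step estimate compares consecutive iterates; the
      index shift disappears in the limit.\<close>
    have "norm (V i (iter m x) - iter (Suc m) (W i x)) \<le> sqrt (2 * d) * norm x" for m
      using norm_step_M_le[OF extension_iter W_in_R[OF i], of m x] extension_iter[of m]
      by (simp add: iter_Suc M_W i nW norm_minus_commute extension_def)
    then show ?thesis
      by (intro LIMSEQ_le_const2[OF tendsto_norm[OF tendsto_diff[OF V LIMSEQ_Suc[OF B]]]]) auto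
  qed
  ultimately show ?thesis by blast
qed

end

section \<open>Row operators\<close>

lemma row_quotient_le:
  assumes C: "0 \<le> C" and y: "y \<in> direct_sum n E"
    and bound: "\<And>F. finite F \<Longrightarrow> F \<subseteq> idx n \<Longrightarrow> norm (\<Sum>i\<in>F. M i (y i)) \<le> C * sqrt (\<Sum>i\<in>F. (norm (y i))\<^sup>2)"
  shows "norm (\<Sum>\<^sub>\<infinity>i\<in>idx n. M i (y i)) / direct_sum_norm n y \<le> C"
proof (cases "(\<lambda>i. M i (y i)) summable_on idx n \<and> direct_sum_norm n y \<noteq> 0")
  case True
  have summ: "(\<lambda>i. (norm (y i))\<^sup>2) summable_on idx n" using y by (simp add: direct_sum_def)
  have "norm (\<Sum>\<^sub>\<infinity>i\<in>idx n. M i (y i)) \<le> C * direct_sum_norm n y"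
  proof (rule tendsto_upperbound)
    show "((\<lambda>F. norm (\<Sum>i\<in>F. M i (y i))) \<longlongrightarrow> norm (\<Sum>\<^sub>\<infinity>i\<in>idx n. M i (y i))) (finite_subsets_at_top (idx n))"
      using True by (intro tendsto_norm infsum_tendsto) simp
    have "norm (\<Sum>i\<in>F. M i (y i)) \<le> C * direct_sum_norm n y" if "finite F" "F \<subseteq> idx n" for F
    proof -
      have "(\<Sum>i\<in>F. (norm (y i))\<^sup>2) \<le> (\<Sum>\<^sub>\<infinity>i\<in>idx n. (norm (y i))\<^sup>2)"
        by (rule finite_sum_le_infsum[OF summ]) (use that in auto)
      then have "C * sqrt (\<Sum>i\<in>F. (norm (y i))\<^sup>2) \<le> C * direct_sum_norm n y"
        unfolding direct_sum_norm_def by (intro mult_left_mono C) simp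
      then show ?thesis using bound[OF that] by linarith
    qed
    then show "\<forall>\<^sub>F F in finite_subsets_at_top (idx n). norm (\<Sum>i\<in>F. M i (y i)) \<le> C * direct_sum_norm n y"
      by (intro eventually_finite_subsets_at_top_weakI) auto
  qed simp
  moreover have "0 \<le> direct_sum_norm n y"
    by (simp add: direct_sum_norm_def infsum_nonneg)
  ultimately show ?thesis using True by (simp add: divide_le_eq)
next
  case False
  \<comment> \<open>A sum that does not converge has the value 0, and so does division by 0; the
    quotient is therefore 0.\<close>
  then show ?thesis using C by (auto simp: infsum_not_exists)
qed

lemma zero_in_direct_sum: "0 \<in> E \<Longrightarrow> (\<lambda>_. 0) \<in> direct_sum n E"
  by (simp add: direct_sum_def)

lemma row_norm_le:
  assumes "0 \<in> E" "0 \<le> C"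
    and bound: "\<And>y F. y \<in> direct_sum n E \<Longrightarrow> finite F \<Longrightarrow> F \<subseteq> idx n \<Longrightarrow>
      norm (\<Sum>i\<in>F. M i (y i)) \<le> C * sqrt (\<Sum>i\<in>F. (norm (y i))\<^sup>2)"
  shows "row_norm n E M \<le> C"
  unfolding row_norm_def
proof (rule cSUP_least)
  fix y assume y: "y \<in> direct_sum n E"
  show "norm (\<Sum>\<^sub>\<infinity>i\<in>idx n. M i (y i)) / direct_sum_norm n y \<le> C"
    using row_quotient_le[where M = M, OF assms(2) y] bound[OF y] by blast
qed (use zero_in_direct_sum[OF assms(1)] in auto)

lemma row_quotient_le_row_norm:
  assumes "0 \<le> C" "y \<in> direct_sum n E"
    and bound: "\<And>y F. y \<in> direct_sum n E \<Longrightarrow> finite F \<Longrightarrow> F \<subseteq> idx n \<Longrightarrow>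
      norm (\<Sum>i\<in>F. M i (y i)) \<le> C * sqrt (\<Sum>i\<in>F. (norm (y i))\<^sup>2)"
  shows "norm (\<Sum>\<^sub>\<infinity>i\<in>idx n. M i (y i)) / direct_sum_norm n y \<le> row_norm n E M"
  unfolding row_norm_def
proof (rule cSUP_upper[OF assms(2)])
  show "bdd_above ((\<lambda>y. norm (\<Sum>\<^sub>\<infinity>i\<in>idx n. M i (y i)) / direct_sum_norm n y) ` direct_sum n E)"
    using row_quotient_le[where M = M, OF assms(1)] bound by (intro bdd_aboveI2) blast
qed

text \<open>The zero family contributes the quotient \<open>0 / 0 = 0\<close> to a supremum that the
  assumed bound keeps finite.\<close>

lemma row_norm_nonneg:
  assumes "0 \<in> E" "0 \<le> C"
    and bound: "\<And>y F. y \<in> direct_sum n E \<Longrightarrow> finite F \<Longrightarrow> F \<subseteq> idx n \<Longrightarrow>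
      norm (\<Sum>i\<in>F. M i (y i)) \<le> C * sqrt (\<Sum>i\<in>F. (norm (y i))\<^sup>2)"
  shows "0 \<le> row_norm n E M"
  using row_quotient_le_row_norm[OF assms(2) zero_in_direct_sum[OF assms(1)] bound]
  by (simp add: direct_sum_norm_def)

lemma norm_sum_le_row_norm:
  assumes E: "0 \<in> E" and C: "0 \<le> C"
    and bound: "\<And>y F. y \<in> direct_sum n E \<Longrightarrow> finite F \<Longrightarrow> F \<subseteq> idx n \<Longrightarrow>
      norm (\<Sum>i\<in>F. M i (y i)) \<le> C * sqrt (\<Sum>i\<in>F. (norm (y i))\<^sup>2)"
    and F: "finite F" "F \<subseteq> idx n" and f: "\<And>i. i \<in> F \<Longrightarrow> f i \<in> E"
    and M0: "\<And>i. i \<in> idx n \<Longrightarrow> M i 0 = 0"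
  shows "norm (\<Sum>i\<in>F. M i (f i)) \<le> row_norm n E M * sqrt (\<Sum>i\<in>F. (norm (f i))\<^sup>2)"
proof -
  \<comment> \<open>Padding by zeros puts the finite family into the direct sum without changing the
    sums.\<close>
  define y where "y i = (if i \<in> F then f i else 0)" for i
  have sq: "((\<lambda>i. (norm (y i))\<^sup>2) has_sum (\<Sum>i\<in>F. (norm (f i))\<^sup>2)) (idx n)"
    by (rule has_sum_finite_neutralI) (use F in \<open>auto simp: y_def\<close>)
  have M: "((\<lambda>i. M i (y i)) has_sum (\<Sum>i\<in>F. M i (f i))) (idx n)"
    by (rule has_sum_finite_neutralI) (use F M0 in \<open>auto simp: y_def\<close>)
  have y: "y \<in> direct_sum n E"
    using sq f E by (auto simp: direct_sum_def summable_on_def y_def)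
  have q: "norm (\<Sum>i\<in>F. M i (f i)) / sqrt (\<Sum>i\<in>F. (norm (f i))\<^sup>2) \<le> row_norm n E M"
    using row_quotient_le_row_norm[OF C y bound] unfolding direct_sum_norm_def infsumI[OF sq] infsumI[OF M] .
  show ?thesis
  proof (cases "(\<Sum>i\<in>F. (norm (f i))\<^sup>2) = 0")
    case True
    then have "\<forall>i\<in>F. f i = 0" using F(1) by (simp add: sum_nonneg_eq_0_iff)
    then show ?thesis using M0 F(2) by (simp add: subset_iff)
  next
    case False
    moreover have "0 \<le> (\<Sum>i\<in>F. (norm (f i))\<^sup>2)" by (simp add: sum_nonneg)
    ultimately have "sqrt (\<Sum>i\<in>F. (norm (f i))\<^sup>2) > 0" by simp
    then show ?thesis using q by (simp add: divide_le_eq)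
  qed
qed

section \<open>Existence of the approximate intertwiner\<close>

lemma isometric_lifting_inner:
  assumes "isometric_lifting n H T V" "i \<in> idx n" "j \<in> idx n"
  shows "inner (V i x) (V j y) = (if i = j then inner x y else 0)"
proof -
  have "V i \<in> bounded_ops UNIV UNIV" and "adj_on UNIV (V i) (V j y) = (if i = j then y else 0)"
    using assms by (auto simp: isometric_lifting_def)
  then show ?thesis using inner_adj_on[of UNIV "V i" UNIV x "V j y"] by (auto split: if_splits)
qed

lemma sqrt_sum_norm_isometric_lifting:
  assumes L: "isometric_lifting n H T V" and F: "finite F" "F \<subseteq> idx n"
  shows "norm (\<Sum>i\<in>F. V i (f i)) = sqrt (\<Sum>i\<in>F. (norm (f i))\<^sup>2)"
proof -
  have "(norm (\<Sum>i\<in>F. V i (f i)))\<^sup>2 = (\<Sum>i\<in>F. (norm (f i))\<^sup>2)"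
    by (rule norm_sum_orthogonal[OF F(1) isometric_lifting_inner[OF L]]) (use F(2) in blast)+
  then show ?thesis by (simp add: real_sqrt_unique)
qed

lemma intertwining_extension:
  fixes \<H> :: "'k::complex_hilbert set" and \<Y> :: "'x::complex_hilbert set"
  assumes H: "closed_csubspace \<H>" and V: "isometric_lifting n \<H> T V"
    and Y: "closed_csubspace \<Y>" and W: "isometric_lifting n \<Y> Y W"
    and A: "A \<in> contractions \<Y> \<H>"
  shows "\<exists>B \<in> contractions UNIV UNIV.
    (\<forall>h\<in>\<H>. adj_on UNIV B h = adj_on \<Y> A h) \<and>
    (\<forall>i\<in>idx n. onorm (\<lambda>x. V i (B x) - B (W i x)) \<le>
       sqrt 2 * sqrt (row_norm n \<Y> (\<lambda>i y. T i (A y) - A (Y i y))))"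
proof -
  define PY where "PY = proj_on \<Y>"
  define P where "P = proj_on \<H>"
  define A' where "A' x = A (PY x)" for x
  define M where commutator_def: "M = (\<lambda>i y. T i (A y) - A (Y i y))"
  define d where "d = row_norm n \<Y> M"
  have PY: "PY x \<in> \<Y>" for x by (simp add: PY_def proj_on_in Y)
  note lin_P = proj_on_linear[OF H, folded P_def] and lin_PY = proj_on_linear[OF Y, folded PY_def]
  have Ab: "A \<in> bounded_ops \<Y> \<H>" using A by (simp add: contractions_def)
  note A_in = bounded_opsD(1)[OF Ab]
  have lin_A': "complex_linear A'"
    unfolding complex_linear_def A'_def
    by (simp add: complex_linear_simps[OF lin_PY] bounded_opsD[OF Ab] PY)
  have A'_le: "norm (A' x) \<le> norm x" for x
    using contractions_norm_le[OF A PY[of x]] norm_proj_on_le[OF Y, of x] by (simp add: A'_def PY_def)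
  have Vb: "V i \<in> bounded_ops UNIV UNIV" and Wb: "W i \<in> bounded_ops UNIV UNIV" if "i \<in> idx n" for i
    using V W that by (auto simp: isometric_lifting_def)
  have PV: "P (V i u) = T i (P u)" and PW: "PY (W i x) = Y i (PY x)" if "i \<in> idx n" for i u x
    using V W that by (auto simp: isometric_lifting_def P_def PY_def)
  have PP: "P (P u) = P u" for u by (simp add: P_def proj_on_id proj_on_in H)
  have P_A: "P (A' x) = A' x" for x by (simp add: P_def A'_def proj_on_id H A_in PY)
  \<comment> \<open>The lifting identities turn \<open>T i A PY\<close> into \<open>P V i A'\<close>
    and \<open>A Y i PY\<close> into \<open>A' W i\<close>.\<close>
  have M_eq: "M i (PY x) = P (V i (A' x)) - A' (W i x)" if "i \<in> idx n" for i x
    using P_A[of x] by (simp add: commutator_def PV PW that A'_def)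
  \<comment> \<open>The crude constant 2 comes from two contractive terms; it ensures that the
    supremum defining \<open>row_norm\<close> is finite.\<close>
  have M_bound: "norm (\<Sum>i\<in>F. M i (y i)) \<le> 2 * sqrt (\<Sum>i\<in>F. (norm (y i))\<^sup>2)"
    if y: "y \<in> direct_sum n \<Y>" and F: "finite F" "F \<subseteq> idx n" for y F
  proof -
    have "(\<Sum>i\<in>F. M i (y i)) = (\<Sum>i\<in>F. P (V i (A' (y i))) - A' (W i (y i)))"
    proof (rule sum.cong)
      fix i assume "i \<in> F"
      then have "i \<in> idx n" "y i \<in> \<Y>" using F y by (auto simp: direct_sum_def)
      then show "M i (y i) = P (V i (A' (y i))) - A' (W i (y i))"
        using M_eq[of i "y i"] by (simp add: PY_def proj_on_id Y)
    qed simp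
    also have "\<dots> = P (\<Sum>i\<in>F. V i (A' (y i))) - A' (\<Sum>i\<in>F. W i (y i))"
      by (simp add: sum_subtractf complex_linear_simps[OF lin_P] complex_linear_simps[OF lin_A'])
    also have "norm \<dots> \<le> norm (P (\<Sum>i\<in>F. V i (A' (y i)))) + norm (A' (\<Sum>i\<in>F. W i (y i)))"
      by (rule norm_triangle_ineq4)
    also have "\<dots> \<le> norm (\<Sum>i\<in>F. V i (A' (y i))) + norm (\<Sum>i\<in>F. W i (y i))"
      unfolding P_def by (intro add_mono norm_proj_on_le H A'_le)
    also have "\<dots> = sqrt (\<Sum>i\<in>F. (norm (A' (y i)))\<^sup>2) + sqrt (\<Sum>i\<in>F. (norm (y i))\<^sup>2)"
      by (simp add: sqrt_sum_norm_isometric_lifting[OF V F] sqrt_sum_norm_isometric_lifting[OF W F])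
    also have "\<dots> \<le> sqrt (\<Sum>i\<in>F. (norm (y i))\<^sup>2) + sqrt (\<Sum>i\<in>F. (norm (y i))\<^sup>2)"
      by (intro add_mono real_sqrt_le_mono sum_mono power_mono A'_le) auto
    finally show ?thesis by simp
  qed
  have zero_Y: "0 \<in> \<Y>" using Y by (simp add: closed_csubspace_def)
  have M0: "M i 0 = 0" if "i \<in> idx n" for i
    using M_eq[OF that, of 0]
    by (simp add: complex_linear_simps(3)[OF lin_P] complex_linear_simps(3)[OF lin_PY]
        complex_linear_simps(3)[OF lin_A'] complex_linear_simps(3)[OF bounded_ops_UNIV_linear[OF Vb[OF that]]]
        complex_linear_simps(3)[OF bounded_ops_UNIV_linear[OF Wb[OF that]]])
  have d0: "0 \<le> d" unfolding d_def by (rule row_norm_nonneg[where C = 2, OF zero_Y _ M_bound]) auto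
  interpret lifting_data "idx n" V W "\<lambda>i. adj_on UNIV (W i)" P A' d
  proof
    fix F and f :: "nat \<Rightarrow> 'x" assume F: "finite F" "F \<subseteq> idx n"
    have "(\<Sum>i\<in>F. P (V i (A' (f i))) - A' (W i (f i))) = (\<Sum>i\<in>F. M i (PY (f i)))"
      using F(2) by (intro sum.cong) (auto simp: M_eq)
    also have "norm \<dots> \<le> d * sqrt (\<Sum>i\<in>F. (norm (PY (f i)))\<^sup>2)"
      unfolding d_def by (rule norm_sum_le_row_norm[where C = 2, OF zero_Y _ M_bound F PY M0]) auto
    also have "\<dots> \<le> d * sqrt (\<Sum>i\<in>F. (norm (f i))\<^sup>2)"
      unfolding PY_def by (intro mult_left_mono real_sqrt_le_mono sum_mono power_mono norm_proj_on_le Y d0) auto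
    finally show "norm (\<Sum>i\<in>F. P (V i (A' (f i))) - A' (W i (f i))) \<le> d * sqrt (\<Sum>i\<in>F. (norm (f i))\<^sup>2)" .
  next
    fix i j x assume "i \<in> idx n" "j \<in> idx n"
    then show "adj_on UNIV (W i) (W j x) = (if i = j then x else 0)"
      using W by (simp add: isometric_lifting_def)
  qed (use V W H Vb Wb in \<open>auto simp: isometric_lifting_inner bounded_ops_UNIV_linear adj_on_UNIV_linear
      lin_P lin_A' PP P_A A'_le d0 PV\<close>, simp add: P_def inner_proj_on_commute)
  obtain B where B: "extension B" and
    le: "\<And>i x. i \<in> idx n \<Longrightarrow> norm (V i (B x) - B (W i x)) \<le> sqrt (2 * d) * norm x"
    using approximate_intertwiner by blast
  have BC: "B \<in> contractions UNIV UNIV"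
    using B by (intro contractions_UNIVI) (auto simp: extension_def)
  show ?thesis
  proof (rule bexI[OF _ BC], intro conjI ballI)
    fix h assume h: "h \<in> \<H>"
    show "adj_on UNIV B h = adj_on \<Y> A h"
    proof (rule adj_on_unique)
      show "B \<in> bounded_ops UNIV UNIV" using BC by (simp add: contractions_def)
      fix x
      \<comment> \<open>The projections move across the inner products because
        \<open>adj_on \<Y> A h\<close> lies in \<open>\<Y>\<close> and \<open>h\<close> in
        \<open>\<H>\<close>.\<close>
      have "inner x (adj_on \<Y> A h) = inner (PY x) (adj_on \<Y> A h)"
        unfolding PY_def by (rule inner_proj_on[OF Y adj_on_in[OF Y Ab], symmetric])
      also have "\<dots> = inner (P (B x)) h"
        using B by (simp add: inner_adj_on[OF Y Ab PY] extension_def A'_def)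
      also have "\<dots> = inner (B x) h" unfolding P_def by (rule inner_proj_on[OF H h])
      finally show "inner x (adj_on \<Y> A h) = inner (B x) h" .
    qed auto
  next
    fix i assume i: "i \<in> idx n"
    have "onorm (\<lambda>x. V i (B x) - B (W i x)) \<le> sqrt (2 * d)"
      by (rule onorm_bound) (use le[OF i] d0 in auto)
    then show "onorm (\<lambda>x. V i (B x) - B (W i x)) \<le>
        sqrt 2 * sqrt (row_norm n \<Y> (\<lambda>i y. T i (A y) - A (Y i y)))"
      by (simp add: real_sqrt_mult d_def commutator_def)
  qed
qed

section \<open>Optimality\<close>

text \<open>By Pythagoras, adding terms to a large finite sum changes it by no more than the tail of
  the scalar series of squared norms allows, so the partial sums form a Cauchy net. This supplies
  strong convergence when \<open>n = \<infinity>\<close>.\<close>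

lemma summable_on_orthogonal:
  fixes f :: "'i \<Rightarrow> 'a::complex_hilbert"
  assumes orth: "\<And>i j. i \<in> I \<Longrightarrow> j \<in> I \<Longrightarrow> i \<noteq> j \<Longrightarrow> inner (f i) (f j) = 0"
    and bound: "\<And>F. finite F \<Longrightarrow> F \<subseteq> I \<Longrightarrow> (\<Sum>i\<in>F. (norm (f i))\<^sup>2) \<le> C"
  shows "f summable_on I"
proof -
  have sq: "(norm (sum f F))\<^sup>2 = (\<Sum>i\<in>F. (norm (f i))\<^sup>2)" if "finite F" "F \<subseteq> I" for F
    using norm_sum_Pythagorean[OF that(1), of f] orth that(2)
    by (auto simp: pairwise_def orthogonal_def subset_iff)
  have summ: "(\<lambda>i. (norm (f i))\<^sup>2) summable_on I"
    by (rule nonneg_bdd_above_summable_on) (use bound in \<open>auto intro!: bdd_aboveI\<close>)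
  define L where "L = (\<Sum>\<^sub>\<infinity>i\<in>I. (norm (f i))\<^sup>2)"
  have "cauchy_filter (filtermap (sum f) (finite_subsets_at_top I))"
    unfolding cauchy_filter_metric_filtermap
  proof (intro allI impI)
    fix e :: real assume e: "e > 0"
    have "\<forall>\<^sub>F F in finite_subsets_at_top I. L - (e/2)\<^sup>2 < (\<Sum>i\<in>F. (norm (f i))\<^sup>2)"
      using infsum_tendsto[OF summ] e unfolding L_def[symmetric] by (intro order_tendstoD(1)) auto
    then obtain F0 where F0: "finite F0" "F0 \<subseteq> I" "L - (e/2)\<^sup>2 < (\<Sum>i\<in>F0. (norm (f i))\<^sup>2)"
      unfolding eventually_finite_subsets_at_top by blast
    have near: "norm (sum f F - sum f F0) < e / 2" if F: "finite F" "F \<subseteq> I" "F0 \<subseteq> F" for F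
    proof (rule power2_less_imp_less)
      have "(norm (sum f F - sum f F0))\<^sup>2 = (\<Sum>i\<in>F - F0. (norm (f i))\<^sup>2)"
        using F F0(1) by (subst sum_diff[symmetric]) (auto intro!: sq)
      also have "\<dots> = (\<Sum>i\<in>F. (norm (f i))\<^sup>2) - (\<Sum>i\<in>F0. (norm (f i))\<^sup>2)"
        using F F0(1) by (simp add: sum_diff)
      also have "(\<Sum>i\<in>F. (norm (f i))\<^sup>2) \<le> L"
        unfolding L_def by (rule finite_sum_le_infsum[OF summ]) (use F in auto)
      finally show "(norm (sum f F - sum f F0))\<^sup>2 < (e / 2)\<^sup>2" using F0(3) by linarith
    qed (use e in simp)
    let ?P = "\<lambda>F. finite F \<and> F \<subseteq> I \<and> F0 \<subseteq> F"
    have ev: "eventually ?P (finite_subsets_at_top I)"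
      unfolding eventually_finite_subsets_at_top using F0 by blast
    have "dist (sum f F) (sum f F') < e" if "?P F" "?P F'" for F F'
      using near[of F] near[of F'] that norm_triangle_ineq4[of "sum f F - sum f F0" "sum f F' - sum f F0"]
      by (simp add: dist_norm)
    with ev show "\<exists>P. eventually P (finite_subsets_at_top I) \<and>
        (\<forall>F F'. P F \<and> P F' \<longrightarrow> dist (sum f F) (sum f F') < e)"
      by (intro exI[of _ ?P] conjI allI impI) (assumption, elim conjE, simp)
  qed
  moreover have "complete (UNIV :: 'a set)"
    by (simp add: complete_def Cauchy_convergent_iff convergent_def)
  ultimately obtain L' where "(sum f \<longlongrightarrow> L') (finite_subsets_at_top I)"
    using complete_uniform[where S = UNIV] by (force simp add: filterlim_def)
  then show ?thesis by (auto simp: summable_on_def has_sum_def)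
qed

text \<open>On the whole space the family lifts itself, its compression being trivial. The summands
  in the row condition are projections of \<open>h\<close> onto orthogonal ranges, so the condition
  is Bessel's inequality.\<close>

lemma orthogonal_isometries:
  assumes Vb: "\<And>i. i \<in> idx n \<Longrightarrow> V i \<in> bounded_ops UNIV UNIV"
    and V: "\<And>i j x y. i \<in> idx n \<Longrightarrow> j \<in> idx n \<Longrightarrow> inner (V i x) (V j y) = (if i = j then inner x y else 0)"
  shows "row_contraction n UNIV V" "isometric_lifting n UNIV V V"
proof -
  let ?a = "\<lambda>i. adj_on UNIV (V i)"
  have adj: "inner x (?a i h) = inner (V i x) h" if "i \<in> idx n" for i x h
    by (rule inner_adj_on) (use Vb that in auto)
  have lift: "?a i (V j x) = (if i = j then x else 0)" if "i \<in> idx n" "j \<in> idx n" for i j x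
    by (rule adj_on_unique[OF _ Vb]) (use V that in auto)
  then show "isometric_lifting n UNIV V V"
    by (simp add: isometric_lifting_def Vb proj_on_id)
  have "(\<lambda>i. V i (?a i h)) summable_on idx n \<and>
      Re (cinner (\<Sum>\<^sub>\<infinity>i\<in>idx n. V i (?a i h)) h) \<le> Re (cinner h h)" for h
  proof -
    have nV: "norm (V i x) = norm x" if "i \<in> idx n" for i x
      using V[OF that that, of x x] by (simp add: norm_eq_sqrt_inner)
    have sum_eq: "inner (\<Sum>i\<in>F. V i (?a i h)) h = (\<Sum>i\<in>F. (norm (?a i h))\<^sup>2)" if "F \<subseteq> idx n" for F
      unfolding inner_sum_left using that
      by (intro sum.cong) (auto simp: adj[symmetric] power2_norm_eq_inner)
    have bound: "(\<Sum>i\<in>F. (norm (?a i h))\<^sup>2) \<le> (norm h)\<^sup>2" if F: "finite F" "F \<subseteq> idx n" for F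
    proof -
      let ?S = "\<Sum>i\<in>F. V i (?a i h)"
      have S: "(norm ?S)\<^sup>2 = (\<Sum>i\<in>F. (norm (?a i h))\<^sup>2)"
        by (rule norm_sum_orthogonal[OF F(1) V]) (use F(2) in blast)+
      then have "norm ?S * norm ?S \<le> norm h * norm ?S"
        using sum_eq[OF F(2)] norm_cauchy_schwarz[of ?S h] by (simp add: power2_eq_square mult.commute)
      then have "norm ?S \<le> norm h" by (cases "?S = 0") auto
      then show ?thesis unfolding S[symmetric] by (rule power_mono) simp
    qed
    have summ: "(\<lambda>i. V i (?a i h)) summable_on idx n"
    proof (rule summable_on_orthogonal)
      fix F assume F: "finite F" "F \<subseteq> idx n"
      have "(\<Sum>i\<in>F. (norm (V i (?a i h)))\<^sup>2) = (\<Sum>i\<in>F. (norm (?a i h))\<^sup>2)"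
        using F(2) by (intro sum.cong) (auto simp: nV)
      then show "(\<Sum>i\<in>F. (norm (V i (?a i h)))\<^sup>2) \<le> (norm h)\<^sup>2" using bound[OF F] by simp
    qed (simp add: V)
    have "inner (\<Sum>\<^sub>\<infinity>i\<in>idx n. V i (?a i h)) h \<le> (norm h)\<^sup>2"
    proof (rule tendsto_upperbound)
      show "((\<lambda>F. inner (\<Sum>i\<in>F. V i (?a i h)) h) \<longlongrightarrow> inner (\<Sum>\<^sub>\<infinity>i\<in>idx n. V i (?a i h)) h)
          (finite_subsets_at_top (idx n))"
        by (intro tendsto_intros infsum_tendsto summ)
      show "\<forall>\<^sub>F F in finite_subsets_at_top (idx n). inner (\<Sum>i\<in>F. V i (?a i h)) h \<le> (norm h)\<^sup>2"
        by (rule eventually_finite_subsets_at_top_weakI) (simp add: sum_eq bound)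
    qed simp
    then show ?thesis using summ by (simp add: inner_eq_Re_cinner power2_norm_eq_inner)
  qed
  then show "row_contraction n UNIV V" by (simp add: row_contraction_def Vb)
qed

section \<open>Isometries with orthogonal ranges on the sequence space\<close>

lemma strict_mono_prod_encode: "strict_mono (\<lambda>k. prod_encode (i, k))"
  by (rule strict_mono_Suc_iff[THEN iffD2]) (simp add: prod_encode_def)

text \<open>The pairing function splits the indices into infinitely many infinite columns, and the
  \<open>i\<close>-th operator copies a sequence onto column \<open>i\<close>. Infinitely many such
  ranges serve every \<open>n\<close>, including \<open>\<infinity>\<close>.\<close>

lift_definition ell2_isometry :: "nat \<Rightarrow> ell2 \<Rightarrow> ell2" is
  "\<lambda>i f m. if fst (prod_decode m) = i then f (snd (prod_decode m)) else 0"
proof -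
  fix i and f :: "nat \<Rightarrow> complex" assume f: "summable (\<lambda>k. (cmod (f k))\<^sup>2)"
  have "summable (\<lambda>k. (\<lambda>m. (cmod (if fst (prod_decode m) = i then f (snd (prod_decode m)) else 0))\<^sup>2) (prod_encode (i, k)))"
    using f by simp
  then show "summable (\<lambda>m. (cmod (if fst (prod_decode m) = i then f (snd (prod_decode m)) else 0))\<^sup>2)"
    by (subst (asm) summable_mono_reindex[OF strict_mono_prod_encode])
      (auto simp: image_iff, metis prod.collapse prod_decode_inverse)
qed

lemma ell2_isometry_inner:
  "inner (ell2_isometry i x) (ell2_isometry j y) = (if i = j then inner x y else 0)"
proof -
  have "cinner (ell2_isometry i x) (ell2_isometry j y) = (if i = j then cinner x y else 0)"
  proof transfer
    fix i j and f g :: "nat \<Rightarrow> complex"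
    let ?h = "\<lambda>m. (if fst (prod_decode m) = i then f (snd (prod_decode m)) else 0) *
      cnj (if fst (prod_decode m) = i then g (snd (prod_decode m)) else 0)"
    have "(\<Sum>k. ?h (prod_encode (i, k))) = (\<Sum>m. ?h m)"
      by (rule suminf_mono_reindex[OF strict_mono_prod_encode])
        (auto simp: image_iff, metis prod.collapse prod_decode_inverse)
    then have "(\<Sum>m. ?h m) = (\<Sum>k. f k * cnj (g k))" by simp
    then show "(\<Sum>m. (if fst (prod_decode m) = i then f (snd (prod_decode m)) else 0) *
        cnj (if fst (prod_decode m) = j then g (snd (prod_decode m)) else 0)) =
        (if i = j then \<Sum>k. f k * cnj (g k) else 0)"
      by (cases "i = j") (simp_all add: if_distrib[of cnj] if_distrib[of "(*) _"] cong: if_cong)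
  qed
  then show ?thesis by (simp add: inner_eq_Re_cinner)
qed

section \<open>Sharpness of the constant\<close>

lemma onorm_ge_if_norm_eq:
  assumes "complex_linear f" "\<And>x. norm (f x) = c * norm x" "x \<noteq> (0::'a::complex_inner)" "0 \<le> c"
  shows "c \<le> onorm (f :: 'a \<Rightarrow> 'b::complex_inner)"
proof -
  have "bounded_linear f"
    using complex_linear_linear[OF assms(1)]
    by (intro bounded_linear_intro[where K = c]) (auto simp: assms(2) linear_add linear_scale)
  then have "c * norm x \<le> onorm f * norm x" using onorm[of f x] by (simp add: assms(2))
  then show ?thesis using assms(3) by simp
qed

text \<open>With \<open>V = - W\<close> and \<open>A = 1\<close> the lifting \<open>B\<close> is forced to be \<open>1\<close>, and both sides equal \<open>2\<close>.\<close>

lemma optimal_constant: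
  assumes n: "1 \<le> n" and c: "c < sqrt 2"
  shows "\<exists>(\<H> :: ell2 set) T V (\<Y> :: ell2 set) Y W A.
    closed_csubspace \<H> \<and> row_contraction n \<H> T \<and> isometric_lifting n \<H> T V \<and>
    closed_csubspace \<Y> \<and> row_contraction n \<Y> Y \<and> isometric_lifting n \<Y> Y W \<and>
    A \<in> contractions \<Y> \<H> \<and>
    \<not> (\<exists>B \<in> contractions UNIV UNIV.
       (\<forall>h\<in>\<H>. adj_on UNIV B h = adj_on \<Y> A h) \<and>
       (\<forall>i\<in>idx n. onorm (\<lambda>x. V i (B x) - B (W i x)) \<le>
          c * sqrt (row_norm n \<Y> (\<lambda>i y. T i (A y) - A (Y i y)))))"
proof -
  let ?W = ell2_isometry and ?V = "\<lambda>i x. - ell2_isometry i x"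
  let ?M = "\<lambda>i y. ?V i y - ?W i y"
  have W_lin: "complex_linear (?W i)" for i
    unfolding complex_linear_def by (intro conjI allI; transfer) auto
  have nW: "norm (?W i x) = norm x" for i x
    using ell2_isometry_inner[of i x i x] by (simp add: norm_eq_sqrt_inner)
  have V_lin: "complex_linear (?V i)" for i
    using W_lin[of i] by (auto simp: complex_linear_def scaleC_linear_simps)
  have Wb: "?W i \<in> bounded_ops UNIV UNIV" for i
    using contractions_UNIVI[OF W_lin[of i]] by (simp add: contractions_def nW)
  have Vb: "?V i \<in> bounded_ops UNIV UNIV" for i
    using contractions_UNIVI[OF V_lin[of i]] by (simp add: contractions_def nW)
  have id: "(\<lambda>x::ell2. x) \<in> contractions UNIV UNIV"
    by (rule contractions_UNIVI) (auto simp: complex_linear_def)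
  note W = orthogonal_isometries[of n ?W, OF Wb ell2_isometry_inner]
  have V: "row_contraction n UNIV ?V" "isometric_lifting n UNIV ?V ?V"
    by (rule orthogonal_isometries; use Vb in \<open>simp add: ell2_isometry_inner\<close>)+
  have bound: "norm (\<Sum>i\<in>F. ?M i (y i)) \<le> 2 * sqrt (\<Sum>i\<in>F. (norm (y i))\<^sup>2)"
    if F: "finite F" "F \<subseteq> idx n" for y F
  proof -
    have "(\<Sum>i\<in>F. ?M i (y i)) = - 2 *\<^sub>R (\<Sum>i\<in>F. ?W i (y i))"
      by (simp add: scaleR_sum_right[symmetric] sum_subtractf sum_negf scaleR_2)
    then show ?thesis by (simp add: sqrt_sum_norm_isometric_lifting[OF W(2) F])
  qed
  have row: "0 \<le> row_norm n UNIV ?M" "row_norm n UNIV ?M \<le> 2"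
    by (rule row_norm_nonneg[where C = 2] row_norm_le[where C = 2]; use bound in simp)+
  have "\<not> (\<exists>B \<in> contractions UNIV UNIV. (\<forall>h\<in>UNIV. adj_on UNIV B h = adj_on UNIV (\<lambda>x. x) h) \<and>
       (\<forall>i\<in>idx n. onorm (\<lambda>x. ?V i (B x) - B (?W i x)) \<le> c * sqrt (row_norm n UNIV ?M)))"
  proof safe
    fix B :: "ell2 \<Rightarrow> ell2"
    assume B: "B \<in> contractions UNIV UNIV"
      and adj: "\<forall>h\<in>UNIV. adj_on UNIV B h = adj_on UNIV (\<lambda>x. x) h"
      and le: "\<forall>i\<in>idx n. onorm (\<lambda>x. ?V i (B x) - B (?W i x)) \<le> c * sqrt (row_norm n UNIV ?M)"
    \<comment> \<open>The adjoint is prescribed on the whole space here, which determines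
      \<open>B\<close>.\<close>
    have Bx: "B x = x" for x
    proof (rule inner_ext_on[where E = UNIV])
      fix h
      have "inner (B x) h = inner x (adj_on UNIV B h)"
        by (rule inner_adj_on[symmetric]) (use B in \<open>auto simp: contractions_def\<close>)
      also have "\<dots> = inner x h"
        using adj id by (simp add: inner_adj_on[where F = UNIV] contractions_def)
      finally show "inner (B x) h = inner x h" .
    qed auto
    obtain e :: ell2 where e: "e \<noteq> 0"
    proof
      have "summable (\<lambda>i::nat. (cmod (if i = 0 then 1 else 0))\<^sup>2)"
        by (rule summable_finite[of "{0}"]) auto
      then have "Rep_ell2 (Abs_ell2 (\<lambda>i. if i = 0 then 1 else 0)) 0 \<noteq> 0"
        by (subst Abs_ell2_inverse) auto
      then show "Abs_ell2 (\<lambda>i. if i = 0 then 1 else 0) \<noteq> 0" by (auto simp: zero_ell2.rep_eq)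
    qed
    have M2: "?M i x = (- 2) *\<^sub>R ?W i x" for i x by (simp add: scaleR_2)
    have "2 \<le> onorm (?M 1)"
    proof (rule onorm_ge_if_norm_eq[OF _ _ e])
      show "complex_linear (?M 1)"
        using W_lin[of 1] by (simp add: complex_linear_def scaleC_linear_simps)
      show "norm (?M 1 x) = 2 * norm x" for x unfolding M2 by (simp add: nW)
    qed simp
    also have "1 \<in> idx n" using n by (simp add: idx_def one_enat_def)
    then have "onorm (?M 1) \<le> c * sqrt (row_norm n UNIV ?M)" using le by (simp add: Bx)
    finally have ge: "2 \<le> c * sqrt (row_norm n UNIV ?M)" .
    \<comment> \<open>As the row norm is at most 2, a nonnegative \<open>c\<close> below
      \<open>sqrt 2\<close> keeps the right side below 2, and a negative \<open>c\<close> makes it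
      nonpositive.\<close>
    show False
    proof (cases "0 \<le> c")
      case True
      have "c * sqrt (row_norm n UNIV ?M) \<le> c * sqrt 2"
        using row True by (intro mult_left_mono) auto
      also have "\<dots> < sqrt 2 * sqrt 2" using c by (intro mult_strict_right_mono) auto
      finally show False using ge by simp
    next
      case False
      then have "c * sqrt (row_norm n UNIV ?M) \<le> 0" using row by (intro mult_nonpos_nonneg) auto
      then show False using ge by simp
    qed
  qed
  then show ?thesis
    using W V id
    by (intro exI[of _ UNIV] exI[of _ ?V] exI[of _ ?W] exI[of _ "\<lambda>x. x"] conjI) auto
qed

theorem theorem1p2:
  fixes n :: enat
  assumes "1 \<le> n"
  shows "(\<forall>(\<H> :: 'k::complex_hilbert set) T V (\<Y> :: 'x::complex_hilbert set) Y W A.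
            closed_csubspace \<H> \<and> row_contraction n \<H> T \<and> isometric_lifting n \<H> T V \<and>
            closed_csubspace \<Y> \<and> row_contraction n \<Y> Y \<and> isometric_lifting n \<Y> Y W \<and>
            A \<in> contractions \<Y> \<H> \<longrightarrow>
            (\<exists>B \<in> contractions UNIV UNIV.
               (\<forall>h\<in>\<H>. adj_on UNIV B h = adj_on \<Y> A h) \<and>
               (\<forall>i\<in>idx n. onorm (\<lambda>x. V i (B x) - B (W i x)) \<le>
                  sqrt 2 * sqrt (row_norm n \<Y> (\<lambda>i y. T i (A y) - A (Y i y)))))) \<and>
         (\<forall>c < sqrt 2. \<not>
           (\<forall>(\<H> :: ell2 set) T V (\<Y> :: ell2 set) Y W A.
            closed_csubspace \<H> \<and> row_contraction n \<H> T \<and> isometric_lifting n \<H> T V \<and>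
            closed_csubspace \<Y> \<and> row_contraction n \<Y> Y \<and> isometric_lifting n \<Y> Y W \<and>
            A \<in> contractions \<Y> \<H> \<longrightarrow>
            (\<exists>B \<in> contractions UNIV UNIV.
               (\<forall>h\<in>\<H>. adj_on UNIV B h = adj_on \<Y> A h) \<and>
               (\<forall>i\<in>idx n. onorm (\<lambda>x. V i (B x) - B (W i x)) \<le>
                  c * sqrt (row_norm n \<Y> (\<lambda>i y. T i (A y) - A (Y i y)))))))"
proof (intro conjI allI impI)
  fix \<H> :: "'k set" and T V and \<Y> :: "'x set" and Y W A
  assume "closed_csubspace \<H> \<and> row_contraction n \<H> T \<and> isometric_lifting n \<H> T V \<and>
    closed_csubspace \<Y> \<and> row_contraction n \<Y> Y \<and> isometric_lifting n \<Y> Y W \<and>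
    A \<in> contractions \<Y> \<H>"
  then show "\<exists>B \<in> contractions UNIV UNIV.
      (\<forall>h\<in>\<H>. adj_on UNIV B h = adj_on \<Y> A h) \<and>
      (\<forall>i\<in>idx n. onorm (\<lambda>x. V i (B x) - B (W i x)) \<le>
         sqrt 2 * sqrt (row_norm n \<Y> (\<lambda>i y. T i (A y) - A (Y i y))))"
    by (intro intertwining_extension) simp_all
next
  fix c :: real assume c: "c < sqrt 2"
  show "\<not> (\<forall>(\<H> :: ell2 set) T V (\<Y> :: ell2 set) Y W A.
      closed_csubspace \<H> \<and> row_contraction n \<H> T \<and> isometric_lifting n \<H> T V \<and>
      closed_csubspace \<Y> \<and> row_contraction n \<Y> Y \<and> isometric_lifting n \<Y> Y W \<and>
      A \<in> contractions \<Y> \<H> \<longrightarrow>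
      (\<exists>B \<in> contractions UNIV UNIV.
         (\<forall>h\<in>\<H>. adj_on UNIV B h = adj_on \<Y> A h) \<and>
         (\<forall>i\<in>idx n. onorm (\<lambda>x. V i (B x) - B (W i x)) \<le>
            c * sqrt (row_norm n \<Y> (\<lambda>i y. T i (A y) - A (Y i y))))))"
    unfolding not_all not_imp using optimal_constant[OF assms c] by (elim exE conjE) (intro exI conjI; assumption)
qed

end
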